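(* Let $k=k(r)$ and $n=n(r)$ be sequences of integers with $k(r)\ge2$ and $n=kr$, and suppose that for some $0<\alpha<1$ we have $k=o(n^{1-\alpha})$ as $r\to\infty$. Let $\lambda=k-1$ and let $\mathbb{E}_n^{\{0,k\}}(\mathbf{B})$ be the expected value of $\mathbf{B}$ over a uniformly random $\{0,k\}$-mapping on $n$ nodes. Then, as $r\to\infty$, $$\log \mathbb{E}_n^{\{0,k\}}(\mathbf{B}) = \frac{3}{2}\left(\frac{n}{\lambda}\right)^{1/3}(1+o(1)).$$
   Context: For a positive integer $n$ let $[n]=\{1,\dots,n\}$. A $\{0,k\}$-mapping on $n$ nodes is a function $f:[n]\to[n]$ with $|f^{-1}(y)|\in\{0,k\}$ for every $y\in[n]$ (so $n=kr$ with $r$ the size of the range). For a mapping $f$, $\mathbf{B}(f)$ is the product of the lengths of all cycles of $f$, counted with multiplicity. Expectation is with respect to the uniform distribution on $\{0,k\}$-mappings on $[n]$. *)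

theory Defs
  imports
    "HOL-Probability.Probability_Mass_Function"
    "HOL-Combinatorics.Orbits"
    "HOL-Library.Landau_Symbols"
begin

text \<open>The mappings live in the extensional function space, so that each mapping on
  \<open>{1..n}\<close> is represented by exactly one HOL function and uniform counting is correct.\<close>

definition zero_k_mappings :: "nat \<Rightarrow> nat \<Rightarrow> (nat \<Rightarrow> nat) set" where
  "zero_k_mappings k n =
     {f \<in> {1..n} \<rightarrow>\<^sub>E {1..n}. \<forall>y\<in>{1..n}. card {x \<in> {1..n}. f x = y} \<in> {0, k}}"

text \<open>A cycle is identified with its set of nodes. Distinct cycles have disjoint node sets,
  so the product below is taken over cycles (not over cycle lengths): a length occurring
  in several cycles is counted with multiplicity.\<close>

definition cycles_on :: "nat \<Rightarrow> (nat \<Rightarrow> nat) \<Rightarrow> nat set set" where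
  "cycles_on n f = {C. C \<subseteq> {1..n} \<and> cyclic_on f C}"

definition cycle_length_product :: "nat \<Rightarrow> (nat \<Rightarrow> nat) \<Rightarrow> nat" where
  "cycle_length_product n f = (\<Prod>C\<in>cycles_on n f. card C)"

text \<open>The set of mappings is finite, and it is nonempty whenever \<open>k > 0\<close> divides \<open>n\<close>;
  only then is the uniform distribution meaningful.\<close>

definition expected_B :: "nat \<Rightarrow> nat \<Rightarrow> real" where
  "expected_B k n =
     measure_pmf.expectation (pmf_of_set (zero_k_mappings k n))
       (\<lambda>f. real (cycle_length_product n f))"

end

theory Submission
  imports Defs "HOL-Real_Asymp.Real_Asymp"
begin

text \<open>Writing each cycle length as \<open>(l - 1) + 1\<close> and expanding the product turns \<open>B(f)\<close> into a sum over
  the sets \<open>A\<close> permuted by \<open>f\<close>, weighted by \<open>l - 1\<close> for each cycle of \<open>f\<close> inside \<open>A\<close>. The number of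
  \<open>{0,k}\<close>-mappings extending a given permutation of \<open>A\<close> depends only on \<open>m = |A|\<close>, so that
  \<open>E(B) = \<Sum>m. Q m * (e m - e (m - 1))\<close> with \<open>Q m = \<Prod>i<m. k (r - i) / (n - i)\<close> (\<open>survival k r m\<close>),
  where \<open>e m\<close> (\<open>lah_coeff m\<close>) is the mean of the product of the cycle lengths over all permutations
  of \<open>m\<close> points. Since \<open>e m\<close> is about
  \<open>exp (2 sqrt m)\<close> and \<open>Q m\<close> is about \<open>exp (- m\<^sup>2 / (2 x))\<close> for \<open>x = n / (k - 1)\<close>, the exponent is
  maximal at \<open>m = x powr (2/3)\<close>, where it equals \<open>3/2 * x powr (1/3)\<close>.\<close>

section \<open>Cycles of a map\<close>

text \<open>The ambient set is a parameter so that the cycles inside a permuted subset can be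
  treated like those on the whole node set.\<close>

definition cycles_in :: "'a set \<Rightarrow> ('a \<Rightarrow> 'a) \<Rightarrow> 'a set set" where
  "cycles_in A f = {C. C \<subseteq> A \<and> cyclic_on f C}"

lemma cycles_on_eq: "cycles_on n f = cycles_in {1..n} f"
  by (simp add: cycles_on_def cycles_in_def)

lemma cycles_in_cong:
  assumes "\<And>x. x \<in> A \<Longrightarrow> f x = g x"
  shows "cycles_in A f = cycles_in A g"
  unfolding cycles_in_def using assms by (metis (no_types, lifting) cyclic_cong subsetD)

lemma finite_cycles_in: "finite A \<Longrightarrow> finite (cycles_in A f)"
  unfolding cycles_in_def by (rule finite_subset[of _ "Pow A"]) auto

lemma cycles_in_eq_orbit: "C \<in> cycles_in A f \<Longrightarrow> x \<in> C \<Longrightarrow> C = orbit f x"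
  by (auto simp: cycles_in_def cyclic_on_alldef)

lemma cycles_in_disjoint:
  "C \<in> cycles_in A f \<Longrightarrow> D \<in> cycles_in A f \<Longrightarrow> C \<noteq> D \<Longrightarrow> C \<inter> D = {}"
  using cycles_in_eq_orbit[of C A f] cycles_in_eq_orbit[of D A f] by (metis disjoint_iff)

lemma card_cycle_pos: "C \<in> cycles_in A f \<Longrightarrow> card C \<ge> 1"
  using finite_cyclic_on[of f C] by (auto simp: cycles_in_def cyclic_on_def Suc_le_eq card_gt_0_iff)

lemma finite_cycle: "C \<in> cycles_in A f \<Longrightarrow> finite C"
  using finite_cyclic_on[of f C] by (simp add: cycles_in_def)

text \<open>A cyclic set is the orbit of each of its points. A cycle inside \<open>A\<close>
  therefore meets some member of the cover \<open>P\<close> and coincides with it.\<close>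

lemma cycles_in_eqI:
  assumes "\<Union>P = A" "\<And>C. C \<in> P \<Longrightarrow> cyclic_on f C"
  shows "cycles_in A f = P"
proof
  show "P \<subseteq> cycles_in A f" using assms by (auto simp: cycles_in_def)
  show "cycles_in A f \<subseteq> P"
  proof
    fix C assume C: "C \<in> cycles_in A f"
    then obtain x where x: "x \<in> C" "x \<in> A"
      by (auto simp: cycles_in_def cyclic_on_alldef)
    then obtain D where D: "D \<in> P" "x \<in> D" using assms by auto
    have "D = C" using cycles_in_eq_orbit[OF C x(1)] assms(2)[OF D(1)] D(2)
      by (simp add: cyclic_on_alldef)
    with D show "C \<in> P" by simp
  qed
qed

text \<open>Each point of a cycle lies in its own orbit, hence is the image of a point of that
  orbit. So \<open>f\<close> maps the finite set \<open>C\<close> onto itself and is injective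
  there.\<close>

lemma cyclic_on_bij_betw:
  assumes "cyclic_on f C" shows "bij_betw f C C"
proof -
  have fin: "finite C" by (rule finite_cyclic_on[OF assms])
  have "C \<subseteq> f ` C"
  proof
    fix y assume y: "y \<in> C"
    hence C: "C = orbit f y" using assms by (simp add: cyclic_on_alldef)
    with y have "y \<in> orbit f y" by simp
    thus "y \<in> f ` C"
    proof cases
      case base thus ?thesis using y by blast
    next
      case (step z) thus ?thesis using C by blast
    qed
  qed
  moreover have "f ` C \<subseteq> C" using cyclic_on_inI[OF assms] by blast
  ultimately have "f ` C = C" by blast
  thus ?thesis using fin by (simp add: bij_betw_def finite_surj_inj)
qed

lemma bij_betw_perm_restrict_permutes:
  assumes "bij_betw f A A" shows "perm_restrict f A permutes A"
proof (rule bij_imp_permutes)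
  show "bij_betw (perm_restrict f A) A A"
    using assms by (rule bij_betw_cong[THEN iffD1, rotated]) (simp add: perm_restrict_def)
qed (simp add: perm_restrict_def)

text \<open>The map \<open>perm_restrict f A\<close> has the same cycles inside \<open>A\<close> and
  is a permutation of a finite set, so every orbit is cyclic and contains its base point.\<close>

lemma Union_cycles_in:
  assumes "finite A" "bij_betw f A A"
  shows "\<Union>(cycles_in A f) = A"
proof -
  let ?p = "perm_restrict f A"
  have p: "?p permutes A" by (rule bij_betw_perm_restrict_permutes[OF assms(2)])
  have eq: "cycles_in A f = cycles_in A ?p"
    by (rule cycles_in_cong) (simp add: perm_restrict_def)
  have "x \<in> \<Union>(cycles_in A ?p)" if x: "x \<in> A" for x
  proof -
    have "orbit ?p x \<in> cycles_in A ?p"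
      using cyclic_on_orbit[OF p assms(1)] permutes_orbit_subset[OF p x] by (simp add: cycles_in_def)
    moreover have "x \<in> orbit ?p x"
      using p assms(1) by (intro permutation_self_in_orbit) (auto simp: permutation_permutes)
    ultimately show ?thesis by blast
  qed
  moreover have "\<Union>(cycles_in A ?p) \<subseteq> A" by (auto simp: cycles_in_def)
  ultimately show ?thesis unfolding eq by blast
qed

text \<open>Injectivity across different cycles holds because a common value
  \<open>f x = f y\<close> lies in both cycles, and cycles sharing a point are equal.\<close>

lemma bij_betw_Union_cycles:
  assumes "S \<subseteq> cycles_in V f" shows "bij_betw f (\<Union>S) (\<Union>S)"
proof -
  have "inj_on f (\<Union>S)"
  proof (rule inj_onI)
    fix x y assume x: "x \<in> \<Union>S" and y: "y \<in> \<Union>S" and e: "f x = f y"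
    obtain C D where C: "C \<in> S" "x \<in> C" and D: "D \<in> S" "y \<in> D" using x y by blast
    have cC: "cyclic_on f C" and cD: "cyclic_on f D"
      using C D assms by (auto simp: cycles_in_def)
    have "f x \<in> C" "f x \<in> D" using e cyclic_on_inI[OF cC C(2)] cyclic_on_inI[OF cD D(2)] by auto
    hence "C = D" using cC cD by (metis cyclic_on_alldef)
    thus "x = y" using cyclic_on_bij_betw[OF cC] C D e by (auto simp: bij_betw_def inj_on_def)
  qed
  moreover have "f ` C = C" if "C \<in> S" for C
    using that assms cyclic_on_bij_betw[of f C] by (auto simp: cycles_in_def bij_betw_def)
  hence "f ` \<Union>S = \<Union>S" by (auto simp: image_Union)
  ultimately show ?thesis by (simp add: bij_betw_def)
qed

section \<open>The product of cycle lengths expanded over permuted subsets\<close>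

text \<open>A set of cycles and its union determine each other, so expanding the product of
  \<open>(l - 1) + 1\<close> gives a sum over subsets of \<open>V\<close>. Indexing by subsets
  instead of sets of cycles prepares the exchange with a sum over maps.\<close>

lemma prod_card_cycles_expand:
  fixes f :: "'a \<Rightarrow> 'a"
  assumes "finite V"
  shows "(\<Prod>C\<in>cycles_in V f. real (card C)) =
    (\<Sum>A | A \<subseteq> V \<and> bij_betw f A A. \<Prod>C\<in>cycles_in A f. real (card C) - 1)"
proof -
  have "(\<Prod>C\<in>cycles_in V f. real (card C)) = (\<Prod>C\<in>cycles_in V f. (real (card C) - 1) + 1)"
    by simp
  also have "\<dots> = (\<Sum>S\<in>Pow (cycles_in V f). \<Prod>C\<in>S. real (card C) - 1)"
    by (subst prod_add) (simp_all add: finite_cycles_in[OF assms])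
  also have "\<dots> = (\<Sum>A | A \<subseteq> V \<and> bij_betw f A A. \<Prod>C\<in>cycles_in A f. real (card C) - 1)"
  proof (rule sum.reindex_bij_witness[of _ "\<lambda>A. cycles_in A f" Union])
    fix S assume "S \<in> Pow (cycles_in V f)"
    hence S: "S \<subseteq> cycles_in V f" by simp
    show eq: "cycles_in (\<Union>S) f = S" 
      using S by (intro cycles_in_eqI) (auto simp: cycles_in_def)
    show "\<Union>S \<in> {A. A \<subseteq> V \<and> bij_betw f A A}"
      using S bij_betw_Union_cycles[OF S] by (auto simp: cycles_in_def)
    show "(\<Prod>C\<in>cycles_in (\<Union> S) f. real (card C) - 1) = (\<Prod>C\<in>S. real (card C) - 1)"
      by (simp add: eq)
  next
    fix A assume A: "A \<in> {A. A \<subseteq> V \<and> bij_betw f A A}"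
    show "\<Union>(cycles_in A f) = A"
      using A assms by (intro Union_cycles_in) (auto intro: finite_subset)
    show "cycles_in A f \<in> Pow (cycles_in V f)"
      using A by (auto simp: cycles_in_def)
  qed
  finally show ?thesis .
qed

lemma cycles_in_insert_fixpoint:
  assumes "q permutes S" "finite S" "a \<notin> S"
  shows "cycles_in (insert a S) q = insert {a} (cycles_in S q)"
proof (rule cycles_in_eqI)
  show "\<Union>(insert {a} (cycles_in S q)) = insert a S"
    using Union_cycles_in[OF assms(2) permutes_imp_bij[OF assms(1)]] by simp
  have "q a = a" using assms by (auto simp: permutes_def)
  hence "orbit q a = {a}" by (simp add: orbit_eq_singleton_iff)
  hence "cyclic_on q {a}" by (auto simp: cyclic_on_def)
  thus "cyclic_on q C" if "C \<in> insert {a} (cycles_in S q)" for C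
    using that by (auto simp: cycles_in_def)
qed

text \<open>Composing with the transposition redirects the preimage of \<open>b\<close> in
  \<open>C\<close> to \<open>a\<close> and sends the former fixed point \<open>a\<close> to
  \<open>b\<close>. This splices \<open>a\<close> into \<open>C\<close> just before \<open>b\<close>
  and leaves all other cycles alone.\<close>

lemma cycles_in_insert_transpose:
  assumes q: "q permutes S" "finite S" "a \<notin> S" and C: "C \<in> cycles_in S q" "b \<in> C"
  shows "cycles_in (insert a S) (Transposition.transpose a b \<circ> q) = insert (insert a C) (cycles_in S q - {C})"
proof (rule cycles_in_eqI)
  let ?p = "Transposition.transpose a b \<circ> q"
  have U: "\<Union>(cycles_in S q) = S"
    using Union_cycles_in[OF q(2) permutes_imp_bij[OF q(1)]] by simp
  show "\<Union>(insert (insert a C) (cycles_in S q - {C})) = insert a S"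
    using U C by auto
  have CS: "C \<subseteq> S" and cyc: "cyclic_on q C" using C by (auto simp: cycles_in_def)
  have aC: "a \<notin> C" using CS q by auto
  have qa: "q a = a" using q by (auto simp: permutes_def)
  have pa: "?p a = b" by (simp add: qa)
  have pb: "?p x = a" if "q x = b" for x using that by simp
  have pn: "?p x = q x" if "x \<in> C" "q x \<noteq> b" for x
    using that cyclic_on_inI[OF cyc, of x] aC by (auto simp: Transposition.transpose_def)
  have Ceq: "C = orbit q b" using cyc C by (simp add: cyclic_on_alldef)
  have b0: "b \<in> orbit ?p a" using orbit.base[of ?p a] pa by simp
  \<comment> \<open>On \<open>C\<close> the map \<open>?p\<close> deviates from \<open>q\<close>
    only where \<open>q\<close> hits \<open>b\<close>, and \<open>b\<close> is reached from
    \<open>a\<close> anyway.\<close>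
  have 1: "x \<in> orbit ?p a" if "x \<in> orbit q b" for x
    using that
  proof induction
    case base
    show ?case
    proof (cases "q b = b")
      case False
      hence "?p b = q b" by (rule pn[OF C(2)])
      thus ?thesis using orbit.step[OF b0] by metis
    next
      case True
      thus ?thesis using b0 by (simp only:)
    qed
  next
    case (step y)
    show ?case
    proof (cases "q y = b")
      case False
      hence "?p y = q y" using step.hyps Ceq by (intro pn) simp_all
      thus ?thesis using orbit.step[OF step.IH] by metis
    next
      case True
      thus ?thesis using b0 by (simp only:)
    qed
  qed
  have "b \<in> q ` C" using cyclic_on_bij_betw[OF cyc] C by (auto simp: bij_betw_def)
  then obtain y where y: "y \<in> C" "q y = b" by auto
  have 2: "a \<in> orbit ?p a" using orbit.step[OF 1, of y] y Ceq pb[OF y(2)] by metis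
  have 3: "x \<in> insert a C" if "x \<in> orbit ?p a" for x
    using that
  proof induction
    case base thus ?case using pa C by simp
  next
    case (step y)
    thus ?case using pa C pb[of y] pn[of y] cyclic_on_inI[OF cyc, of y] by (cases "y = a"; cases "q y = b") auto
  qed
  have "orbit ?p a = insert a C" using 1 2 3 Ceq by blast
  hence cC: "cyclic_on ?p (insert a C)" by (auto simp: cyclic_on_def)
  show "cyclic_on ?p D" if "D \<in> insert (insert a C) (cycles_in S q - {C})" for D
  proof (cases "D = insert a C")
    case False
    hence D: "D \<in> cycles_in S q" "D \<noteq> C" using that by auto
    have "C \<inter> D = {}" using cycles_in_disjoint[OF C(1) D(1)] D(2) by blast
    hence bD: "b \<notin> D" using C by auto
    have aD: "a \<notin> D" using D q by (auto simp: cycles_in_def)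
    have cD: "cyclic_on q D" using D by (simp add: cycles_in_def)
    have "cyclic_on ?p D = cyclic_on q D"
    proof (rule cyclic_cong)
      fix s assume "s \<in> D"
      thus "?p s = q s" using cyclic_on_inI[OF cD, of s] aD bD by (auto simp: Transposition.transpose_def)
    qed
    thus ?thesis using cD by simp
  qed (use cC in simp)
qed

section \<open>Permutations weighted by the product of their cycle lengths\<close>

text \<open>The number of permutations of \<open>S\<close> with \<open>j\<close> cycles and one marked point in each cycle. Cutting
  every cycle at its marked point gives a partition of \<open>S\<close> into \<open>j\<close> nonempty lists, so these are the
  Lah numbers.\<close>

definition marked_perms :: "'a set \<Rightarrow> nat \<Rightarrow> real" where
  "marked_perms S j = (\<Sum>p | p permutes S.
     if card (cycles_in S p) = j then \<Prod>C\<in>cycles_in S p. real (card C) else 0)"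

text \<open>Every permutation of \<open>insert a S\<close> is \<open>transpose a b\<close> after
  \<open>q\<close> for a unique \<open>b\<close> and a unique permutation \<open>q\<close> of
  \<open>S\<close>. For \<open>b = a\<close> a new fixed point arises. For \<open>b\<close> in a
  cycle \<open>C\<close> the weight is multiplied by \<open>1 + 1 / card C\<close>. Summed over
  \<open>b\<close> in \<open>C\<close> this gives \<open>card C + 1\<close>, and over all
  \<open>j\<close> cycles \<open>card S + j\<close>.\<close>

lemma marked_perms_insert:
  assumes S: "finite S" "a \<notin> S"
  shows "marked_perms (insert a S) j =
    (if j = 0 then 0 else marked_perms S (j - 1)) + (card S + j) * marked_perms S j"
proof -
  define F where "F = (\<lambda>p. if card (cycles_in (insert a S) p) = j
      then \<Prod>C\<in>cycles_in (insert a S) p. real (card C) else 0)"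
  have Fa: "F (Transposition.transpose a a \<circ> q) = (if j = 0 then 0 else if card (cycles_in S q) = j - 1
      then \<Prod>C\<in>cycles_in S q. real (card C) else 0)" if q: "q permutes S" for q
  proof -
    have "{a} \<notin> cycles_in S q" using S by (auto simp: cycles_in_def)
    thus ?thesis
      unfolding F_def using cycles_in_insert_fixpoint[OF q S] finite_cycles_in[OF S(1), of q] by auto
  qed
  have Fb: "F (Transposition.transpose a b \<circ> q) = (if card (cycles_in S q) = j
      then (\<Prod>C\<in>cycles_in S q. real (card C)) * (1 + 1 / card C) else 0)"
    if q: "q permutes S" and C: "C \<in> cycles_in S q" "b \<in> C" for q C b
  proof -
    have fin: "finite (cycles_in S q)" by (rule finite_cycles_in[OF S(1)])
    have n: "insert a C \<notin> cycles_in S q - {C}" using S by (auto simp: cycles_in_def)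
    have "a \<notin> C" using C S by (auto simp: cycles_in_def)
    hence ci: "real (card (insert a C)) = real (card C) + 1" using finite_cycle[OF C(1)] by simp
    have cp: "real (card C) \<noteq> 0" using card_cycle_pos[OF C(1)] by simp
    have "card (insert (insert a C) (cycles_in S q - {C})) = card (cycles_in S q)"
      using card_insert_disjoint[OF _ n] fin card_Suc_Diff1[OF fin C(1)] by (metis finite_Diff)
    moreover have "(\<Prod>D\<in>insert (insert a C) (cycles_in S q - {C}). real (card D)) =
       (\<Prod>D\<in>cycles_in S q. real (card D)) * (1 + 1 / card C)"
      using n fin ci cp prod.remove[OF fin C(1), of "\<lambda>D. real (card D)"]
      by (simp only: prod.insert finite_Diff) (simp add: field_simps)
    ultimately show ?thesis
      unfolding F_def cycles_in_insert_transpose[OF q S C] by simp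
  qed
  have sumb: "(\<Sum>b\<in>S. F (Transposition.transpose a b \<circ> q)) = (card S + j) * (if card (cycles_in S q) = j
      then \<Prod>C\<in>cycles_in S q. real (card C) else 0)" if q: "q permutes S" for q
  proof -
    let ?P = "cycles_in S q"
    have U: "\<Union>?P = S"
      using Union_cycles_in[OF S(1) permutes_imp_bij[OF q]] by simp
    have sp: "(\<Sum>b\<in>S. g b) = (\<Sum>C\<in>?P. \<Sum>b\<in>C. g b)" for g :: "_ \<Rightarrow> real"
    proof -
      have "sum g (\<Union>?P) = (sum \<circ> sum) g ?P"
        by (rule sum.Union_disjoint) (use finite_cycle cycles_in_disjoint in blast)+
      thus ?thesis by (simp add: U)
    qed
    have "(\<Sum>b\<in>S. F (Transposition.transpose a b \<circ> q)) = (\<Sum>C\<in>?P. \<Sum>b\<in>C. F (Transposition.transpose a b \<circ> q))"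
      by (rule sp)
    also have "\<dots> = (\<Sum>C\<in>?P. \<Sum>b\<in>C. (if card ?P = j
      then (\<Prod>C\<in>?P. real (card C)) * (1 + 1 / card C) else 0))"
      by (intro sum.cong refl Fb q)
    also have "\<dots> = (\<Sum>C\<in>?P. (if card ?P = j then \<Prod>C\<in>?P. real (card C) else 0) * (card C + 1))"
      using card_cycle_pos[of _ S q] by (intro sum.cong) (fastforce simp: field_simps)+
    also have "\<dots> = (if card ?P = j then \<Prod>C\<in>?P. real (card C) else 0) * ((\<Sum>C\<in>?P. real (card C)) + card ?P)"
      by (simp add: sum_distrib_left[symmetric] sum.distrib)
    also have "(\<Sum>C\<in>?P. real (card C)) = card S"
      using sp[of "\<lambda>_. 1"] by simp
    finally show ?thesis by (simp add: comp_def mult.commute)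
  qed
  have "marked_perms (insert a S) j = (\<Sum>b\<in>insert a S. \<Sum>q | q permutes S. F (Transposition.transpose a b \<circ> q))"
    unfolding marked_perms_def F_def by (rule sum_over_permutations_insert[OF S])
  also have "\<dots> = (\<Sum>q | q permutes S. F (Transposition.transpose a a \<circ> q)) + (\<Sum>b\<in>S. \<Sum>q | q permutes S. F (Transposition.transpose a b \<circ> q))"
    using S by simp
  also have "(\<Sum>b\<in>S. \<Sum>q | q permutes S. F (Transposition.transpose a b \<circ> q)) =
      (\<Sum>q | q permutes S. \<Sum>b\<in>S. F (Transposition.transpose a b \<circ> q))"
    by (rule sum.swap)
  also have "\<dots> = (card S + j) * marked_perms S j"
    unfolding marked_perms_def sum_distrib_left by (intro sum.cong refl sumb) simp
  also have "(\<Sum>q | q permutes S. F (Transposition.transpose a a \<circ> q)) = (if j = 0 then 0 else marked_perms S (j - 1))"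
    unfolding marked_perms_def by (subst sum.cong[OF refl Fa]) auto
  finally show ?thesis .
qed

lemma marked_perms_empty: "marked_perms {} j = (if j = 0 then 1 else 0)"
proof -
  have "cycles_in {} (id :: 'a \<Rightarrow> 'a) = {}" by (auto simp: cycles_in_def cyclic_on_def)
  thus ?thesis by (auto simp: marked_perms_def)
qed

lemma marked_perms_0: "finite S \<Longrightarrow> S \<noteq> {} \<Longrightarrow> marked_perms S 0 = 0"
  by (induction rule: finite_ne_induct) (auto simp: marked_perms_insert marked_perms_empty)

text \<open>The closed form of the Lah numbers, proved by induction with the recurrence
  \<open>marked_perms_insert\<close>. The shift to \<open>Suc j\<close> keeps the lower index of the
  binomial free of subtraction.\<close>

lemma marked_perms_Suc:
  assumes "finite S" "S \<noteq> {}"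
  shows "marked_perms S (Suc j) = fact (card S) / fact (Suc j) * ((card S - 1) choose j)"
  using assms
proof (induction arbitrary: j rule: finite_ne_induct)
  case (singleton a)
  show ?case by (subst marked_perms_insert) (auto simp: marked_perms_empty)
next
  case (insert a S)
  obtain m where m: "card S = Suc m" using insert.hyps by (cases "card S") auto
  have IH: "marked_perms S (Suc j) = fact (Suc m) / fact (Suc j) * (m choose j)" for j
    using insert.IH[of j] m by simp
  show ?case
  proof (cases j)
    case 0
    thus ?thesis using insert.hyps m marked_perms_0[of S]
      by (simp add: marked_perms_insert IH)
  next
    case (Suc i)
    have "Suc i * (m choose Suc i) = (m - i) * (m choose i)"
      by (metis binomial_absorb_comp binomial_absorption mult.commute)
    hence "real (Suc i * (m choose Suc i)) = real ((m - i) * (m choose i))" by (rule arg_cong)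
    hence "real (Suc i) * (m choose Suc i) = (real m - real i) * (m choose i)"
      by (cases "i \<le> m") (simp_all add: of_nat_diff binomial_eq_0 algebra_simps)
    \<comment> \<open>Once the factorials are divided out, the recurrence is exactly this identity,
      a rearrangement of the absorption rule above. The coefficient \<open>m + i + 3\<close> is
      \<open>card S + Suc j\<close>.\<close>
    hence "real (m choose i) * (i + 2) + (m + i + 3) * (m choose Suc i) =
        (m + 2) * ((m choose i) + (m choose Suc i))"
      by (simp add: algebra_simps)
    note key = this
    define F G c d where "F = (fact (Suc m) :: real)" and "G = (fact (Suc i) :: real)"
      and "c = real (m choose i)" and "d = real (m choose Suc i)"
    have f: "(fact (Suc (Suc m)) :: real) = (m + 2) * F" "(fact (Suc (Suc i)) :: real) = (i + 2) * G"
      unfolding F_def G_def by (simp_all add: fact_Suc[of "Suc i"] fact_Suc[of "Suc m"] del: fact_Suc)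
    have G: "G > 0" unfolding G_def by simp
    have "marked_perms (insert a S) (Suc j) = F / G * c + (m + i + 3) * (F / ((i + 2) * G) * d)"
      using insert.hyps m
      by (simp add: marked_perms_insert IH Suc f F_def[symmetric] G_def[symmetric] c_def d_def del: fact_Suc)
    also have "F / G * c = F / ((i + 2) * G) * (c * (i + 2))" 
    proof -
      have "real (i + 2) \<noteq> 0" by simp
      thus ?thesis using G by (simp only: times_divide_eq_left times_divide_eq_right mult_ac) (simp add: mult_divide_mult_cancel_left)
    qed
    also have "\<dots> + (m + i + 3) * (F / ((i + 2) * G) * d) = F / ((i + 2) * G) * (c * (i + 2) + (m + i + 3) * d)"
      by (simp only: distrib_left mult_ac)
    also have "c * (i + 2) + (m + i + 3) * d = (m + 2) * (c + d)"
      using key by (simp add: c_def d_def algebra_simps)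
    finally show ?thesis using insert.hyps m
      by (simp add: Suc f c_def d_def del: fact_Suc)
  qed
qed

text \<open>The coefficient of \<open>z ^ m\<close> in \<open>exp (z / (1 - z))\<close>; the index
  \<open>j\<close> stands for \<open>j + 1\<close> cycles. The case \<open>m = 0\<close> is separate
  because the empty permutation has weight 1 although it has no cycle.\<close>

definition lah_coeff :: "nat \<Rightarrow> real" where
  "lah_coeff m = (if m = 0 then 1 else \<Sum>j<m. ((m - 1) choose j) / fact (Suc j))"

text \<open>Permutations are sorted by their number of cycles, which turns the sum into a sum of Lah
  numbers.\<close>

lemma sum_prod_card_cycles:
  assumes "finite S"
  shows "(\<Sum>p | p permutes S. \<Prod>C\<in>cycles_in S p. real (card C)) = fact (card S) * lah_coeff (card S)"
proof (cases "S = {}")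
  case True
  have "cycles_in {} (id :: 'a \<Rightarrow> 'a) = {}" by (auto simp: cycles_in_def cyclic_on_def)
  thus ?thesis using True by (simp add: lah_coeff_def)
next
  case False
  \<comment> \<open>\<open>N\<close> is a crude bound on the number of cycles, namely the number of
    subsets of \<open>S\<close>. It only makes the index range finite; the terms beyond
    \<open>m\<close> vanish with their binomials.\<close>
  define m N where "m = card S" and "N = (2 :: nat) ^ m"
  have m: "m \<noteq> 0" using False assms by (simp add: m_def)
  have "m < N" unfolding N_def by (rule less_exp)
  have "card (cycles_in S p) \<le> N" for p
    unfolding N_def m_def card_Pow[OF assms, symmetric]
    using assms by (intro card_mono) (auto simp: cycles_in_def)
  hence "(\<Sum>p | p permutes S. \<Prod>C\<in>cycles_in S p. real (card C)) =
      (\<Sum>p | p permutes S. \<Sum>j\<le>N. if card (cycles_in S p) = j then \<Prod>C\<in>cycles_in S p. real (card C) else 0)"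
    by simp
  also have "\<dots> = (\<Sum>j\<le>N. marked_perms S j)"
    unfolding marked_perms_def by (rule sum.swap)
  also have "\<dots> = (\<Sum>j<N. marked_perms S (Suc j))"
    by (simp add: sum.atMost_shift marked_perms_0[OF assms False])
  also have "\<dots> = (\<Sum>j<m. marked_perms S (Suc j))"
    using m \<open>m < N\<close> by (intro sum.mono_neutral_right) (auto simp: marked_perms_Suc[OF assms False] m_def[symmetric] binomial_eq_0)
  also have "\<dots> = fact m * lah_coeff m"
    using m unfolding lah_coeff_def by (simp add: marked_perms_Suc[OF assms False] m_def[symmetric] sum_distrib_left del: fact_Suc)
  finally show ?thesis by (simp add: m_def)
qed

section \<open>Exchanging the sum over maps with the sum over permuted subsets\<close>

text \<open>If \<open>f\<close> permutes \<open>A\<close>, it agrees on \<open>A\<close> with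
  exactly one permutation of \<open>A\<close>, namely \<open>perm_restrict f A\<close>; otherwise
  with none. The family \<open>F\<close> is arbitrary because the lemma serves twice: for all
  permutations of a set and for the \<open>{0,k}\<close>-mappings.\<close>

lemma sum_over_permuted_subsets:
  fixes F :: "('a \<Rightarrow> 'a) set"
  assumes "finite F" "finite V"
  shows "(\<Sum>f\<in>F. \<Prod>C\<in>cycles_in V f. real (card C)) =
    (\<Sum>A\<in>Pow V. \<Sum>\<sigma> | \<sigma> permutes A.
       (\<Prod>C\<in>cycles_in A \<sigma>. real (card C) - 1) * card {f \<in> F. \<forall>x\<in>A. f x = \<sigma> x})"
proof -
  define w where "w = (\<lambda>A f. \<Prod>C\<in>cycles_in A f. real (card (C :: 'a set)) - 1)"
  have inner: "(\<Sum>\<sigma> | \<sigma> permutes A. if \<forall>x\<in>A. f x = \<sigma> x then w A \<sigma> else 0) =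
      (if bij_betw f A A then w A f else 0)" if A: "A \<in> Pow V" for A f
  proof (cases "bij_betw f A A")
    case True
    have fin: "finite A" using A assms by (auto intro: finite_subset)
    have "(\<Sum>\<sigma> | \<sigma> permutes A. if \<forall>x\<in>A. f x = \<sigma> x then w A \<sigma> else 0) =
      (\<Sum>\<sigma> | \<sigma> permutes A. if perm_restrict f A = \<sigma> then w A \<sigma> else 0)"
    proof (rule sum.cong[OF refl])
      fix \<sigma> assume "\<sigma> \<in> {\<sigma>. \<sigma> permutes A}"
      hence "(\<forall>x\<in>A. f x = \<sigma> x) \<longleftrightarrow> perm_restrict f A = \<sigma>"
        by (auto simp: perm_restrict_def permutes_def fun_eq_iff)
      thus "(if \<forall>x\<in>A. f x = \<sigma> x then w A \<sigma> else 0) = (if perm_restrict f A = \<sigma> then w A \<sigma> else 0)"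
        by simp
    qed
    also have "\<dots> = w A (perm_restrict f A)"
      using bij_betw_perm_restrict_permutes[OF True] finite_permutations[OF fin]
      by (simp add: sum.delta)
    also have "\<dots> = w A f"
      unfolding w_def by (subst cycles_in_cong[of A _ f]) (auto simp: perm_restrict_def)
    finally show ?thesis using True by simp
  next
    case False
    have "\<not> (\<forall>x\<in>A. f x = \<sigma> x)" if "\<sigma> permutes A" for \<sigma>
      using False permutes_imp_bij[OF that] bij_betw_cong[of A f \<sigma> A] by blast
    thus ?thesis using False by (intro trans[OF sum.neutral]) auto
  qed
  have "(\<Sum>A\<in>Pow V. \<Sum>\<sigma> | \<sigma> permutes A. w A \<sigma> * card {f \<in> F. \<forall>x\<in>A. f x = \<sigma> x}) =
    (\<Sum>A\<in>Pow V. \<Sum>\<sigma> | \<sigma> permutes A. \<Sum>f\<in>F. if \<forall>x\<in>A. f x = \<sigma> x then w A \<sigma> else 0)"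
    using assms(1) by (intro sum.cong refl) (simp add: sum.If_cases Int_def)
  also have "\<dots> = (\<Sum>A\<in>Pow V. \<Sum>f\<in>F. \<Sum>\<sigma> | \<sigma> permutes A. if \<forall>x\<in>A. f x = \<sigma> x then w A \<sigma> else 0)"
    by (intro sum.cong refl sum.swap)
  also have "\<dots> = (\<Sum>A\<in>Pow V. \<Sum>f\<in>F. if bij_betw f A A then w A f else 0)"
    by (intro sum.cong refl inner)
  also have "\<dots> = (\<Sum>f\<in>F. \<Sum>A\<in>Pow V. if bij_betw f A A then w A f else 0)"
    by (rule sum.swap)
  also have "\<dots> = (\<Sum>f\<in>F. \<Sum>A | A \<subseteq> V \<and> bij_betw f A A. w A f)"
    using assms(2) by (subst sum.If_cases) (auto simp: Int_def)
  also have "\<dots> = (\<Sum>f\<in>F. \<Prod>C\<in>cycles_in V f. real (card C))"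
    unfolding w_def by (intro sum.cong refl prod_card_cycles_expand[OF assms(2), symmetric])
  finally show ?thesis by (simp add: w_def)
qed

lemma sum_Pow_card:
  fixes g :: "nat \<Rightarrow> real"
  assumes "finite S"
  shows "(\<Sum>A\<in>Pow S. g (card A)) = (\<Sum>m\<le>card S. real (card S choose m) * g m)"
proof -
  have "(\<Sum>A\<in>Pow S. g (card A)) = (\<Sum>m\<le>card S. \<Sum>A\<in>{A \<in> Pow S. card A = m}. g (card A))"
    using assms by (intro sum.group[symmetric]) (auto intro: card_mono)
  also have "\<dots> = (\<Sum>m\<le>card S. real (card S choose m) * g m)"
    using n_subsets[OF assms] by (intro sum.cong refl) simp
  finally show ?thesis .
qed

text \<open>Composing with \<open>inv \<sigma>\<close> makes such a permutation fix \<open>A\<close>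
  pointwise, so it becomes a permutation of the complement.\<close>

lemma card_permutes_extend:
  assumes S: "finite S" "A \<subseteq> S" and \<sigma>: "\<sigma> permutes A"
  shows "card {p \<in> {p. p permutes S}. \<forall>x\<in>A. p x = \<sigma> x} = fact (card S - card A)"
proof -
  have fin: "finite A" using S by (rule finite_subset[rotated])
  have "bij_betw (\<lambda>q. q \<circ> \<sigma>) {q. q permutes (S - A)} {p \<in> {p. p permutes S}. \<forall>x\<in>A. p x = \<sigma> x}"
  proof (rule bij_betw_byWitness[where f' = "\<lambda>p. p \<circ> inv \<sigma>"])
    show "\<forall>q\<in>{q. q permutes S - A}. q \<circ> \<sigma> \<circ> inv \<sigma> = q"
      by (simp only: comp_assoc permutes_inv_o(1)[OF \<sigma>] comp_id) blast
    show "\<forall>p\<in>{p \<in> {p. p permutes S}. \<forall>x\<in>A. p x = \<sigma> x}. p \<circ> inv \<sigma> \<circ> \<sigma> = p"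
      by (simp only: comp_assoc permutes_inv_o(2)[OF \<sigma>] comp_id) blast
    show "(\<lambda>q. q \<circ> \<sigma>) ` {q. q permutes S - A} \<subseteq> {p \<in> {p. p permutes S}. \<forall>x\<in>A. p x = \<sigma> x}"
    proof safe
      fix q assume q: "q permutes S - A"
      show "q \<circ> \<sigma> permutes S"
        using permutes_subset[OF \<sigma> S(2)] permutes_subset[OF q, of S] by (intro permutes_compose) auto
      fix x assume "x \<in> A"
      thus "(q \<circ> \<sigma>) x = \<sigma> x"
        using permutes_in_image[OF \<sigma>, of x] permutes_not_in[OF q, of "\<sigma> x"] by simp
    qed
    show "(\<lambda>p. p \<circ> inv \<sigma>) ` {p \<in> {p. p permutes S}. \<forall>x\<in>A. p x = \<sigma> x} \<subseteq> {q. q permutes S - A}"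
    proof safe
      fix p assume p: "p permutes S" "\<forall>x\<in>A. p x = \<sigma> x"
      have i: "inv \<sigma> permutes A" by (rule permutes_inv[OF \<sigma>])
      have "p \<circ> inv \<sigma> permutes S"
        by (rule permutes_compose[OF permutes_subset[OF i S(2)] p(1)])
      moreover have "(p \<circ> inv \<sigma>) x = x" if "x \<in> A" for x
        using that p(2) permutes_in_image[OF i, of x] permutes_inverses[OF \<sigma>] by simp
      ultimately show "p \<circ> inv \<sigma> permutes S - A"
        by (rule permutes_superset) simp
    qed
  qed
  hence "card {p \<in> {p. p permutes S}. \<forall>x\<in>A. p x = \<sigma> x} = card {q. q permutes (S - A)}"
    by (rule bij_betw_same_card[symmetric])
  also have "\<dots> = fact (card S - card A)"
    using S fin by (intro card_permutations) (auto simp: card_Diff_subset)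
  finally show ?thesis .
qed

text \<open>The coefficients of \<open>(1 - z) * exp (z / (1 - z))\<close>: consecutive differences
  of \<open>lah_coeff\<close>, with the term before index 0 read as 0.\<close>

definition lah_diff :: "nat \<Rightarrow> real" where
  "lah_diff m = (if m = 0 then 1 else lah_coeff m - lah_coeff (m - 1))"

lemma sum_lah_diff: "(\<Sum>m\<le>n. lah_diff m) = lah_coeff n"
  by (induction n) (auto simp: lah_diff_def lah_coeff_def)

text \<open>Expanding the product of cycle lengths for all permutations of \<open>S\<close>
  expresses \<open>fact n * lah_coeff n\<close> through the sums \<open>w A\<close> for
  \<open>A \<subseteq> S\<close>. Proper subsets are known by induction. The claimed values satisfy
  the same relation because \<open>lah_diff\<close> telescopes, so \<open>w S\<close> must be the
  claimed one.\<close>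

lemma sum_prod_card_cycles_minus_1:
  assumes "finite S"
  shows "(\<Sum>p | p permutes S. \<Prod>C\<in>cycles_in S p. real (card C) - 1) = fact (card S) * lah_diff (card S)"
  using assms
proof (induction rule: finite_psubset_induct)
  case (psubset S)
  define w where "w = (\<lambda>A :: 'a set. \<Sum>p | p permutes A. \<Prod>C\<in>cycles_in A p. real (card C) - 1)"
  define n where "n = card S"
  have w: "w A = fact (card A) * lah_diff (card A)" if "A \<subset> S" for A
    using psubset.IH[OF that] by (simp add: w_def)
  have "fact n * lah_coeff n = (\<Sum>A\<in>Pow S. \<Sum>\<sigma> | \<sigma> permutes A.
       (\<Prod>C\<in>cycles_in A \<sigma>. real (card C) - 1) * card {p \<in> {p. p permutes S}. \<forall>x\<in>A. p x = \<sigma> x})"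
    unfolding n_def sum_prod_card_cycles[OF psubset.hyps, symmetric]
    by (rule sum_over_permuted_subsets[OF finite_permutations[OF psubset.hyps] psubset.hyps])
  also have "\<dots> = (\<Sum>A\<in>Pow S. w A * fact (n - card A))"
    unfolding w_def n_def sum_distrib_right
    using card_permutes_extend[OF psubset.hyps] by (intro sum.cong refl) simp
  also have "\<dots> = w S + (\<Sum>A\<in>Pow S - {S}. w A * fact (n - card A))"
    using psubset.hyps by (subst sum.remove[of _ S]) (auto simp: n_def)
  also have "(\<Sum>A\<in>Pow S - {S}. w A * fact (n - card A)) =
      (\<Sum>A\<in>Pow S - {S}. fact (card A) * lah_diff (card A) * fact (n - card A))"
    by (intro sum.cong refl) (use w in auto)
  also have "\<dots> = (\<Sum>A\<in>Pow S. fact (card A) * lah_diff (card A) * fact (n - card A)) - fact n * lah_diff n"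
    using psubset.hyps by (subst sum.remove[of "Pow S" S]) (auto simp: n_def)
  also have "(\<Sum>A\<in>Pow S. fact (card A) * lah_diff (card A) * fact (n - card A)) =
      (\<Sum>m\<le>n. real (n choose m) * (fact m * lah_diff m * fact (n - m)))"
    unfolding n_def by (rule sum_Pow_card[OF psubset.hyps])
  also have "\<dots> = (\<Sum>m\<le>n. fact n * lah_diff m)"
    by (intro sum.cong refl) (simp add: binomial_fact)
  also have "\<dots> = fact n * lah_coeff n"
    by (simp add: sum_distrib_left[symmetric] sum_lah_diff)
  finally show ?case by (simp add: w_def n_def)
qed

text \<open>The combinatorial meaning gives the sign: every factor \<open>card C - 1\<close> is
  nonnegative. This permits estimating the expectation term by term.\<close>

lemma lah_diff_nonneg: "lah_diff m \<ge> 0"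
proof -
  have "fact m * lah_diff m = (\<Sum>p | p permutes {..<m}. \<Prod>C\<in>cycles_in {..<m} p. real (card C) - 1)"
    by (subst sum_prod_card_cycles_minus_1) simp_all
  also have "\<dots> \<ge> 0"
    using card_cycle_pos by (intro sum_nonneg prod_nonneg) fastforce
  finally have "fact m * 0 \<le> fact m * lah_diff m" by simp
  thus ?thesis by (rule mult_left_le_imp_le) (rule fact_gt_zero)
qed

section \<open>Counting mappings with prescribed fibers\<close>

text \<open>The multinomial coefficient, with its denominator multiplied out to stay in the natural
  numbers. The induction removes a point \<open>a\<close> from the domain and lowers the prescribed
  fiber size at its image by one.\<close>

lemma card_maps_with_fibers:
  assumes "finite U" "finite V" "(\<Sum>y\<in>V. s y) = card U"
  shows "card {f \<in> U \<rightarrow>\<^sub>E V. \<forall>y\<in>V. card {x\<in>U. f x = y} = s y} * (\<Prod>y\<in>V. fact (s y)) = fact (card U)"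
  using assms(1,3)
proof (induction arbitrary: s rule: finite_induct)
  case empty
  hence "s y = 0" if "y \<in> V" for y using that assms(2) by simp
  thus ?case by simp
next
  case (insert a U)
  define F where "F = {f \<in> insert a U \<rightarrow>\<^sub>E V. \<forall>y\<in>V. card {x\<in>insert a U. f x = y} = s y}"
  define G where "G = (\<lambda>s. {f \<in> U \<rightarrow>\<^sub>E V. \<forall>y\<in>V. card {x\<in>U. f x = y} = s y})"
  have finF: "finite F" unfolding F_def
    by (rule finite_subset[OF _ finite_PiE[of "insert a U" "\<lambda>_. V"]]) (use insert.hyps assms(2) in auto)
  have fib: "card {x\<in>insert a U. f x = y} = (if f a = y then 1 else 0) + card {x\<in>U. f x = y}" for f and y :: 'b
  proof -
    have "{x\<in>insert a U. f x = y} = (if f a = y then insert a {x\<in>U. f x = y} else {x\<in>U. f x = y})"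
      by auto
    thus ?thesis using insert.hyps by simp
  qed
  have fib': "{x\<in>U. (f(a := z)) x = y} = {x\<in>U. f x = y}" for f and y z :: 'b
    using insert.hyps by auto
  \<comment> \<open>The case \<open>s z = 0\<close> is separate: no map can then send
    \<open>a\<close> to \<open>z\<close>, and \<open>s z - 1\<close> would be truncated.\<close>
  have term_eq: "card {f \<in> F. f a = z} * (\<Prod>y\<in>V. fact (s y)) = s z * fact (card U)" if z: "z \<in> V" for z
  proof (cases "s z = 0")
    case True
    have "f a \<noteq> z" if "f \<in> F" for f
      using that z True insert.hyps fib[of f z] by (auto simp: F_def)
    hence "{f \<in> F. f a = z} = {}" by auto
    hence "card {f \<in> F. f a = z} = 0" by (simp only: card.empty)
    thus ?thesis using True by (simp only: mult_0)
  next
    case False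
    define s' where "s' = s(z := s z - 1)"
    \<comment> \<open>\<open>undefined\<close> is the value that the extensional function space on
      \<open>U\<close> prescribes at \<open>a\<close>.\<close>
    have "bij_betw (\<lambda>f. f(a := undefined)) {f \<in> F. f a = z} (G s')"
    proof (rule bij_betw_byWitness[where f' = "\<lambda>g. g(a := z)"])
      show "\<forall>f\<in>{f \<in> F. f a = z}. (f(a := undefined))(a := z) = f" by auto
      show "\<forall>g\<in>G s'. (g(a := z))(a := undefined) = g"
      proof
        fix g assume "g \<in> G s'"
        hence "g a = undefined" using insert.hyps by (auto simp: G_def)
        thus "(g(a := z))(a := undefined) = g" by auto
      qed
      show "(\<lambda>f. f(a := undefined)) ` {f \<in> F. f a = z} \<subseteq> G s'"
      proof safe
        fix f assume f: "f \<in> F" "z = f a"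
        have "f(a := undefined) \<in> U \<rightarrow>\<^sub>E V"
          using f insert.hyps by (auto simp: F_def PiE_def extensional_def)
        moreover have "card {x\<in>U. f x = y} = s' y" if "y \<in> V" for y
          using f that fib[of f y] by (auto simp: F_def s'_def)
        ultimately show "f(a := undefined) \<in> G s'"
          unfolding G_def by (simp add: fib' del: fun_upd_apply)
      qed
      show "(\<lambda>g. g(a := z)) ` G s' \<subseteq> {f \<in> F. f a = z}"
      proof safe
        fix g assume g: "g \<in> G s'"
        have "g(a := z) \<in> insert a U \<rightarrow>\<^sub>E V"
          using g z by (auto simp: G_def PiE_def extensional_def)
        moreover have "card {x\<in>insert a U. (g(a := z)) x = y} = s y" if "y \<in> V" for y
          unfolding fib fib' using g that False by (auto simp: G_def s'_def)
        ultimately show "g(a := z) \<in> F" unfolding F_def by blast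
      qed simp
    qed
    hence "card {f \<in> F. f a = z} = card (G s')" by (rule bij_betw_same_card)
    moreover have "(\<Prod>y\<in>V. fact (s y)) = s z * (\<Prod>y\<in>V. fact (s' y) :: nat)"
    proof -
      have "(\<Prod>y\<in>V. fact (s y)) = fact (s z) * (\<Prod>y\<in>V - {z}. fact (s y) :: nat)"
        by (rule prod.remove[OF assms(2) z])
      also have "(\<Prod>y\<in>V - {z}. fact (s y)) = (\<Prod>y\<in>V - {z}. fact (s' y) :: nat)"
        by (intro prod.cong) (auto simp: s'_def)
      also have "fact (s z) = s z * (fact (s' z) :: nat)"
        using False by (simp add: s'_def fact_reduce)
      finally show ?thesis using prod.remove[OF assms(2) z, of "\<lambda>y. fact (s' y) :: nat"]
        by (simp only: mult.assoc)
    qed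
    moreover have "card (G s') * (\<Prod>y\<in>V. fact (s' y)) = fact (card U)"
      unfolding G_def
    proof (rule insert.IH)
      have "sum s V = s z + sum s (V - {z})" by (rule sum.remove[OF assms(2) z])
      moreover have "sum s' V = s' z + sum s' (V - {z})" by (rule sum.remove[OF assms(2) z])
      moreover have "sum s' (V - {z}) = sum s (V - {z})" by (intro sum.cong) (auto simp: s'_def)
      ultimately show "sum s' V = card U"
        using insert.prems insert.hyps False by (simp add: s'_def)
    qed
    ultimately show ?thesis by (metis mult.assoc mult.commute)
  qed
  have "(\<lambda>f. f a) ` F \<subseteq> V" by (auto simp: F_def)
  hence "card F = (\<Sum>z\<in>V. card {f \<in> F. f a = z})"
    using sum.group[OF finF assms(2), of "\<lambda>f. f a" "\<lambda>_. 1 :: nat"] by simp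
  hence "card F * (\<Prod>y\<in>V. fact (s y)) = (\<Sum>z\<in>V. s z * fact (card U))"
    by (simp add: sum_distrib_right term_eq)
  also have "\<dots> = fact (card (insert a U))"
    using insert by (simp add: sum_distrib_right[symmetric])
  finally show ?case by (simp add: F_def)
qed

lemma card_supersets:
  assumes "finite V" "A \<subseteq> V" "card A \<le> r"
  shows "card {R. A \<subseteq> R \<and> R \<subseteq> V \<and> card R = r} = (card V - card A) choose (r - card A)"
proof -
  have finA: "finite A" using assms finite_subset by blast
  have "bij_betw (\<lambda>R. R - A) {R. A \<subseteq> R \<and> R \<subseteq> V \<and> card R = r} {B. B \<subseteq> V - A \<and> card B = r - card A}"
  proof (rule bij_betw_byWitness[where f' = "\<lambda>B. B \<union> A"])
    show "(\<lambda>B. B \<union> A) ` {B. B \<subseteq> V - A \<and> card B = r - card A} \<subseteq> {R. A \<subseteq> R \<and> R \<subseteq> V \<and> card R = r}"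
    proof safe
      fix B assume B: "B \<subseteq> V - A" "card B = r - card A"
      have "card (B \<union> A) = card B + card A"
        using B finA assms by (intro card_Un_disjoint) (auto intro: finite_subset)
      thus "card (B \<union> A) = r" using B assms by simp
    qed (use assms in auto)
  qed (use finA in \<open>auto simp: card_Diff_subset\<close>)
  hence "card {R. A \<subseteq> R \<and> R \<subseteq> V \<and> card R = r} = card {B. B \<subseteq> V - A \<and> card B = r - card A}"
    by (rule bij_betw_same_card)
  also have "\<dots> = (card V - card A) choose (r - card A)"
    using n_subsets[of "V - A"] assms finA by (simp add: card_Diff_subset)
  finally show ?thesis .
qed

text \<open>The image of such a map is a set \<open>R\<close> of \<open>r\<close> nodes that
  contains \<open>A\<close>. With \<open>R\<close> fixed, the values outside \<open>A\<close> are
  free up to the fiber sizes, which gives a multinomial coefficient; the binomial counts the choices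
  of \<open>R\<close>.\<close>

lemma card_regular_maps_extending:
  assumes V: "finite V" "card V = k * r" "k > 0" and A: "A \<subseteq> V" and \<sigma>: "\<sigma> permutes A"
  defines "F \<equiv> {f \<in> {f \<in> V \<rightarrow>\<^sub>E V. \<forall>y\<in>V. card {x\<in>V. f x = y} \<in> {0, k}}. \<forall>x\<in>A. f x = \<sigma> x}"
  shows "card A \<le> r \<Longrightarrow> card F * (fact (k - 1) ^ card A * fact k ^ (r - card A)) =
      ((k * r - card A) choose (r - card A)) * fact (k * r - card A)"
    and "card A > r \<Longrightarrow> card F = 0"
proof -
  have finA: "finite A" using V A finite_subset by blast
  define G where "G = (\<lambda>R. {f \<in> V \<rightarrow>\<^sub>E V. (\<forall>y\<in>V. card {x\<in>V. f x = y} = (if y \<in> R then k else 0)) \<and> (\<forall>x\<in>A. f x = \<sigma> x)})"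
  define RR where "RR = {R. A \<subseteq> R \<and> R \<subseteq> V \<and> card R = r}"
  have finF: "finite F" unfolding F_def
    by (rule finite_subset[OF _ finite_PiE[of V "\<lambda>_. V"]]) (use V in auto)
  have F: "f ` V \<in> RR \<and> f \<in> G (f ` V)" if f: "f \<in> F" for f
  proof -
    have im: "f ` V \<subseteq> V" using f by (auto simp: F_def)
    have fib: "card {x\<in>V. f x = y} = (if y \<in> f ` V then k else 0)" if y: "y \<in> V" for y
    proof (cases "y \<in> f ` V")
      case True
      hence "{x\<in>V. f x = y} \<noteq> {}" by auto
      hence "card {x\<in>V. f x = y} \<noteq> 0" using V by simp
      thus ?thesis using f y True unfolding F_def by fastforce
    next
      case False
      hence "{x\<in>V. f x = y} = {}" by auto
      hence "card {x\<in>V. f x = y} = 0" by (simp only: card.empty)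
      thus ?thesis using False by simp
    qed
    \<comment> \<open>Every nonempty fiber has \<open>k\<close> points, so the image has
      \<open>r\<close>.\<close>
    have "card V = (\<Sum>y\<in>f ` V. card {x\<in>V. f x = y})"
      using sum.group[of V "f ` V" f "\<lambda>_. 1 :: nat"] V by auto
    also have "\<dots> = (\<Sum>y\<in>f ` V. k)" by (intro sum.cong refl) (use fib im in auto)
    finally have "card (f ` V) = r" using V by simp
    moreover have "A \<subseteq> f ` V"
    proof
      fix y assume y: "y \<in> A"
      then obtain x where "x \<in> A" "\<sigma> x = y"
        using permutes_image[OF \<sigma>] by (metis imageE)
      moreover from this have "f x = y" using f by (auto simp: F_def)
      ultimately show "y \<in> f ` V" using A by (metis imageI subsetD)
    qed
    ultimately show ?thesis using im fib f by (auto simp: RR_def G_def F_def)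
  qed
  show "card F = 0" if "card A > r"
  proof -
    have "F = {}"
    proof (rule ccontr)
      assume "F \<noteq> {}"
      then obtain f where "f \<in> F" by blast
      from F[OF this] have "A \<subseteq> f ` V" "card (f ` V) = r" by (auto simp: RR_def)
      hence "card A \<le> r" using V by (metis card_mono finite_imageI)
      thus False using that by simp
    qed
    thus ?thesis by simp
  qed
  assume mr: "card A \<le> r"
  have cardG: "card (G R) * (fact (k - 1) ^ card A * fact k ^ (r - card A)) = fact (k * r - card A)"
    if R: "R \<in> RR" for R
  proof -
    \<comment> \<open>These are the fiber sizes left for the nodes outside \<open>A\<close>: each
      node of \<open>A\<close> already has one preimage under \<open>\<sigma>\<close>.\<close>
    define s where "s = (\<lambda>y. if y \<in> A then k - 1 else if y \<in> R then k else 0)"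
    define H where "H = {g \<in> (V - A) \<rightarrow>\<^sub>E V. \<forall>y\<in>V. card {x\<in>V - A. g x = y} = s y}"
    have fib: "card {x\<in>V. f x = y} = card {x\<in>V - A. f x = y} + (if y \<in> A then 1 else 0)"
      if f: "\<forall>x\<in>A. f x = \<sigma> x" for f and y
    proof -
      have "{x\<in>V. f x = y} = {x\<in>V - A. f x = y} \<union> {x\<in>A. \<sigma> x = y}" using f A by auto
      also have "card \<dots> = card {x\<in>V - A. f x = y} + card {x\<in>A. \<sigma> x = y}"
        using V finA by (intro card_Un_disjoint) auto
      also have "{x\<in>A. \<sigma> x = y} = (if y \<in> A then {inv \<sigma> y} else {})"
        using permutes_inverses[OF \<sigma>] permutes_in_image[OF \<sigma>] permutes_in_image[OF permutes_inv[OF \<sigma>]] by auto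
      finally show ?thesis by simp
    qed
    have RV: "A \<subseteq> R" "R \<subseteq> V" "card R = r" using R by (auto simp: RR_def)
    have "bij_betw (\<lambda>f. restrict f (V - A)) (G R) H"
    proof (rule bij_betw_byWitness[where f' = "\<lambda>g x. if x \<in> A then \<sigma> x else g x"])
      show "\<forall>f\<in>G R. (\<lambda>x. if x \<in> A then \<sigma> x else restrict f (V - A) x) = f"
        using A by (fastforce simp: G_def fun_eq_iff PiE_def extensional_def)
      show "\<forall>g\<in>H. restrict (\<lambda>x. if x \<in> A then \<sigma> x else g x) (V - A) = g"
        by (auto simp: H_def fun_eq_iff PiE_def extensional_def restrict_def)
      show "(\<lambda>f. restrict f (V - A)) ` G R \<subseteq> H"
      proof safe
        fix f assume f: "f \<in> G R"
        have "{x\<in>V - A. restrict f (V - A) x = y} = {x\<in>V - A. f x = y}" for y by auto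
        moreover have "card {x\<in>V - A. f x = y} = s y" if "y \<in> V" for y
          using f that fib[of f y] RV V(3) by (auto simp: G_def s_def split: if_splits)
        moreover have "restrict f (V - A) \<in> (V - A) \<rightarrow>\<^sub>E V" using f by (auto simp: G_def)
        ultimately show "restrict f (V - A) \<in> H" unfolding H_def by simp
      qed
      show "(\<lambda>g x. if x \<in> A then \<sigma> x else g x) ` H \<subseteq> G R"
      proof safe
        fix g assume g: "g \<in> H"
        let ?f = "\<lambda>x. if x \<in> A then \<sigma> x else g x"
        have "?f \<in> V \<rightarrow>\<^sub>E V"
        proof (rule PiE_I)
          fix x assume "x \<in> V"
          thus "?f x \<in> V"
            using g A permutes_in_image[OF \<sigma>, of x] by (cases "x \<in> A") (auto simp: H_def)
        next
          fix x assume "x \<notin> V"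
          thus "?f x = undefined"
            using g A by (auto simp: H_def PiE_def extensional_def)
        qed
        moreover have "{x\<in>V - A. ?f x = y} = {x\<in>V - A. g x = y}" for y by auto
        hence "card {x\<in>V. ?f x = y} = (if y \<in> R then k else 0)" if "y \<in> V" for y
          using g that fib[of ?f y] RV V(3) by (auto simp: H_def s_def)
        ultimately show "?f \<in> G R" unfolding G_def by simp
      qed
    qed
    hence GH: "card (G R) = card H" by (rule bij_betw_same_card)
    have finR: "finite R" using RV V finite_subset by blast
    have "sum s V = sum s A + sum s (R - A) + sum s (V - R)"
      using sum.subset_diff[OF RV(2) V(1), of s] sum.subset_diff[OF RV(1) finR, of s] by simp
    also have "sum s A = card A * (k - 1)" by (simp add: s_def)
    also have "sum s (R - A) = (r - card A) * k"
      using RV finA by (simp add: s_def card_Diff_subset)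
    also have "sum s (V - R) = 0" using RV by (intro sum.neutral) (auto simp: s_def)
    also have "card A * (k - 1) + (r - card A) * k + 0 = card (V - A)"
    proof -
      obtain k' where k': "k = Suc k'" using V(3) by (cases k) auto
      obtain d where d: "r = card A + d" using mr le_Suc_ex by blast
      show ?thesis unfolding card_Diff_subset[OF finA A] V(2) d k' by (simp add: algebra_simps)
    qed
    finally have sums: "sum s V = card (V - A)" .
    have "(\<Prod>y\<in>V. fact (s y)) = (\<Prod>y\<in>A. fact (s y)) * (\<Prod>y\<in>R - A. fact (s y)) * (\<Prod>y\<in>V - R. fact (s y) :: nat)"
      using prod.subset_diff[OF RV(2) V(1), of "\<lambda>y. fact (s y) :: nat"]
        prod.subset_diff[OF RV(1) finR, of "\<lambda>y. fact (s y) :: nat"] by (simp only: mult_ac)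
    also have "(\<Prod>y\<in>A. fact (s y)) = (fact (k - 1) ^ card A :: nat)" by (simp add: s_def)
    also have "(\<Prod>y\<in>R - A. fact (s y)) = (fact k ^ (r - card A) :: nat)"
      using RV finA by (simp add: s_def card_Diff_subset)
    also have "(\<Prod>y\<in>V - R. fact (s y)) = (1 :: nat)" using RV by (intro prod.neutral) (auto simp: s_def)
    finally have prods: "(\<Prod>y\<in>V. fact (s y)) = (fact (k - 1) ^ card A * fact k ^ (r - card A) :: nat)" by simp
    have "card H * (\<Prod>y\<in>V. fact (s y)) = fact (card (V - A))"
      unfolding H_def by (rule card_maps_with_fibers) (use V sums in auto)
    thus ?thesis unfolding GH prods card_Diff_subset[OF finA A] V(2) .
  qed
  have finRR: "finite RR" unfolding RR_def using V by (auto intro: finite_subset[of _ "Pow V"])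
  \<comment> \<open>The classes of \<open>F\<close> with a given image are the sets
    \<open>G R\<close>.\<close>
  have "{f \<in> F. f ` V = R} = G R" if R: "R \<in> RR" for R
  proof safe
    fix f assume "f \<in> F" thus "f \<in> G (f ` V)" using F by blast
  next
    fix f assume f: "f \<in> G R"
    thus "f \<in> F" by (auto simp: F_def G_def)
    have nz: "y \<in> f ` V \<longleftrightarrow> card {x\<in>V. f x = y} \<noteq> 0" for y using V by auto
    fix y 
    have im: "f ` V \<subseteq> V" using f by (auto simp: G_def)
    show "y \<in> f ` V" if "y \<in> R"
      using that f R V(3) unfolding nz by (auto simp: G_def RR_def)
    show "f x \<in> R" if "x \<in> V" for x
    proof -
      have "card {x'\<in>V. f x' = f x} \<noteq> 0" using nz that by blast
      moreover have "f x \<in> V" using im that by blast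
      ultimately show ?thesis using f by (auto simp: G_def split: if_splits)
    qed
  qed
  moreover have "(\<lambda>f. f ` V) ` F \<subseteq> RR" using F by blast
  ultimately have "card F = (\<Sum>R\<in>RR. card (G R))"
    using sum.group[OF finF finRR, of "\<lambda>f. f ` V" "\<lambda>_. 1 :: nat"] by simp
  hence "card F * (fact (k - 1) ^ card A * fact k ^ (r - card A)) =
      (\<Sum>R\<in>RR. card (G R) * (fact (k - 1) ^ card A * fact k ^ (r - card A)))"
    by (simp only: sum_distrib_right)
  also have "\<dots> = (\<Sum>R\<in>RR. fact (k * r - card A))" by (intro sum.cong refl cardG)
  also have "\<dots> = card RR * fact (k * r - card A)" by simp
  also have "card RR = (k * r - card A) choose (r - card A)"
    unfolding RR_def using card_supersets[OF V(1) A mr] V(2) by simp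
  finally show "card F * (fact (k - 1) ^ card A * fact k ^ (r - card A)) =
      ((k * r - card A) choose (r - card A)) * fact (k * r - card A)" .
qed

section \<open>The exact formula for the expectation\<close>

text \<open>By absorption, lowering both arguments of the binomial by one multiplies it by the ratio
  of the lower to the upper argument.\<close>

lemma binomial_diff_eq_prod:
  assumes "m \<le> r" "r \<le> n"
  shows "real ((n - m) choose (r - m)) = (n choose r) * (\<Prod>i<m. (real r - real i) / (real n - real i))"
  using assms(1)
proof (induction m)
  case (Suc m)
  obtain a b where ab: "n - m = Suc a" "r - m = Suc b" "n - Suc m = a" "r - Suc m = b"
    using Suc.prems assms(2) by (metis Suc_diff_Suc Suc_le_lessD less_le_trans)
  have "Suc a * (a choose b) = (Suc a choose Suc b) * Suc b" by (rule Suc_times_binomial_eq)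
  hence "real (Suc a) * (a choose b) = (Suc a choose Suc b) * real (Suc b)"
    by (metis of_nat_mult)
  moreover have "real (Suc a) = real n - m" "real (Suc b) = real r - m"
    using Suc.prems assms(2) ab by linarith+
  ultimately have "real (a choose b) = (Suc a choose Suc b) * ((real r - m) / (real n - m))"
    by (metis mult.commute nonzero_eq_divide_eq of_nat_eq_0_iff old.nat.distinct(2) times_divide_eq_right)
  thus ?case using Suc ab by simp
qed simp

text \<open>The probability that a random \<open>{0,k}\<close>-mapping on \<open>k * r\<close> nodes has at least \<open>m\<close> cyclic nodes.\<close>

definition survival :: "nat \<Rightarrow> nat \<Rightarrow> nat \<Rightarrow> real" where
  "survival k r m = (\<Prod>i<m. real k * (real r - real i) / (real (k * r) - real i))"

text \<open>The number \<open>N\<close> of mappings extending a permutation of \<open>A\<close>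
  depends only on \<open>card A\<close>. Hence the sum over permutations becomes a factorial times
  \<open>lah_diff\<close>, and the sum over subsets a sum over sizes with binomial weights.\<close>

lemma expected_B_eq:
  assumes "k > 0"
  shows "expected_B k (k * r) = (\<Sum>m\<le>r. survival k r m * lah_diff m)"
proof -
  define n where "n = k * r"
  define V where "V = {1..n}"
  define F where "F = {f \<in> V \<rightarrow>\<^sub>E V. \<forall>y\<in>V. card {x\<in>V. f x = y} \<in> {0, k}}"
  have V: "finite V" "card V = k * r" by (auto simp: V_def n_def)
  have rn: "r \<le> n" using assms by (simp add: n_def)
  have Feq: "zero_k_mappings k n = F" by (simp add: zero_k_mappings_def F_def V_def)
  have finF: "finite F" unfolding F_def
    by (rule finite_subset[OF _ finite_PiE[of V "\<lambda>_. V"]]) (use V in auto)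
  \<comment> \<open>The total count is the case \<open>A = {}\<close>. It also shows that the
    uniform distribution lives on a nonempty set.\<close>
  have N0: "card F * fact k ^ r = (n choose r) * fact n"
    using card_regular_maps_extending(1)[OF V assms, of "{}" id] unfolding F_def n_def by simp
  have "(n choose r) * fact n > (0 :: nat)" using rn by simp
  hence F0: "card F > 0" using N0 by (metis gr0I mult_0 less_irrefl)
  define N :: "nat \<Rightarrow> real" where "N = (\<lambda>m. if m \<le> r then ((n - m) choose (r - m)) * fact (n - m) /
     (fact (k - 1) ^ m * fact k ^ (r - m)) else 0)"
  have N: "card {f \<in> F. \<forall>x\<in>A. f x = \<sigma> x} = N (card A)" if A: "A \<subseteq> V" and \<sigma>: "\<sigma> permutes A" for A \<sigma>
  proof (cases "card A \<le> r")
    case True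
    have "real (card {f \<in> F. \<forall>x\<in>A. f x = \<sigma> x} * (fact (k - 1) ^ card A * fact k ^ (r - card A))) =
        real (((n - card A) choose (r - card A)) * fact (n - card A))"
      using card_regular_maps_extending(1)[OF V assms A \<sigma> True] unfolding F_def n_def by (rule arg_cong)
    thus ?thesis using True by (simp add: N_def field_simps)
  next
    case False
    thus ?thesis using card_regular_maps_extending(2)[OF V assms A \<sigma>] unfolding F_def N_def by simp
  qed
  have "(\<Sum>f\<in>F. real (cycle_length_product n f)) = (\<Sum>f\<in>F. \<Prod>C\<in>cycles_in V f. real (card C))"
    by (simp add: cycle_length_product_def cycles_on_eq V_def)
  also have "\<dots> = (\<Sum>A\<in>Pow V. \<Sum>\<sigma> | \<sigma> permutes A.
       (\<Prod>C\<in>cycles_in A \<sigma>. real (card C) - 1) * card {f \<in> F. \<forall>x\<in>A. f x = \<sigma> x})"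
    by (rule sum_over_permuted_subsets[OF finF V(1)])
  also have "\<dots> = (\<Sum>A\<in>Pow V. (\<Sum>\<sigma> | \<sigma> permutes A. \<Prod>C\<in>cycles_in A \<sigma>. real (card C) - 1) * N (card A))"
    unfolding sum_distrib_right using N by (intro sum.cong refl) simp
  also have "\<dots> = (\<Sum>A\<in>Pow V. fact (card A) * lah_diff (card A) * N (card A))"
    using finite_subset[OF _ V(1)] by (intro sum.cong refl) (simp add: sum_prod_card_cycles_minus_1)
  also have "\<dots> = (\<Sum>m\<le>n. real (n choose m) * (fact m * lah_diff m * N m))"
    using sum_Pow_card[OF V(1), of "\<lambda>m. fact m * lah_diff m * N m"] V(2) by (simp add: n_def)
  also have "\<dots> = (\<Sum>m\<le>r. real (n choose m) * (fact m * lah_diff m * N m))"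
    using rn by (intro sum.mono_neutral_right) (auto simp: N_def)
  also have "\<dots> = (\<Sum>m\<le>r. card F * (survival k r m * lah_diff m))"
  proof (intro sum.cong refl)
    fix m assume "m \<in> {..r}"
    hence m: "m \<le> r" by simp
    \<comment> \<open>This turns the powers of \<open>fact (k - 1)\<close> into those of
      \<open>fact k\<close> and yields the factor \<open>k ^ m\<close> of
      \<open>survival k r m\<close>.\<close>
    have kk: "fact k = real k * fact (k - 1)" using assms by (simp add: fact_reduce)
    have "real (card F * fact k ^ r) = real ((n choose r) * fact n)" using N0 by (rule arg_cong)
    hence cF: "card F = (n choose r) * fact n / fact k ^ r" by (simp add: field_simps)
    have "survival k r m = real k ^ m * (\<Prod>i<m. (real r - real i) / (real n - real i))"
      unfolding survival_def n_def by (simp add: prod.distrib prod_dividef power_divide)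
    hence nr: "(n choose r) * survival k r m = real k ^ m * ((n - m) choose (r - m))"
      using binomial_diff_eq_prod[OF m rn] by simp
    have "real (n choose m) * fact m * N m = fact n * (((n - m) choose (r - m)) / (fact (k - 1) ^ m * fact k ^ (r - m)))"
      using m rn by (simp add: N_def binomial_fact)
    also have "\<dots> = fact n * (real k ^ m * ((n - m) choose (r - m)) / (fact k ^ m * fact k ^ (r - m)))"
      unfolding kk power_mult_distrib using assms by simp
    also have "fact k ^ m * fact k ^ (r - m) = (fact k ^ r :: real)"
      using m by (simp flip: power_add)
    also have "fact n * (real k ^ m * ((n - m) choose (r - m)) / fact k ^ r) = card F * survival k r m"
      unfolding cF nr[symmetric] by simp
    finally show "real (n choose m) * (fact m * lah_diff m * N m) = card F * (survival k r m * lah_diff m)"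
      by (simp add: mult_ac)
  qed
  finally have "(\<Sum>f\<in>F. real (cycle_length_product n f)) = card F * (\<Sum>m\<le>r. survival k r m * lah_diff m)"
    by (simp add: sum_distrib_left)
  moreover have "expected_B k n = (\<Sum>f\<in>F. real (cycle_length_product n f)) / card F"
    unfolding expected_B_def Feq using finF F0 by (intro integral_pmf_of_set) auto
  ultimately show ?thesis using F0 by (simp add: n_def)
qed

section \<open>Asymptotics\<close>

lemma lah_coeff_nonneg: "lah_coeff m \<ge> 0"
  by (auto simp: lah_coeff_def intro!: sum_nonneg divide_nonneg_nonneg)

text \<open>Each summand is at most the square of a term of the exponential series at
  \<open>sqrt m\<close>. A sum of squares of nonnegative numbers is at most the square of their
  sum.\<close>

lemma lah_coeff_upper: "lah_coeff m \<le> exp (2 * sqrt m)"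
proof (cases m)
  case (Suc n)
  define b where "b = (\<lambda>j. sqrt m ^ j / fact j)"
  have b0: "b j \<ge> 0" for j by (simp add: b_def)
  have sb: "b sums exp (sqrt m)"
    using exp_converges[of "sqrt m"] by (simp add: b_def divide_inverse mult.commute)
  have sum_b: "sum b A \<le> exp (sqrt m)" if "finite A" for A
    using sum_le_suminf[OF sums_summable[OF sb] that] sums_unique[OF sb] b0 by simp
  have term_le: "(n choose j) / fact (Suc j) \<le> exp (sqrt m) * b (Suc j)" for j
  proof -
    have "(n choose j) * fact (Suc j) \<le> (m choose Suc j) * fact (Suc j)"
      by (intro mult_right_mono) (simp_all add: Suc)
    also have "\<dots> \<le> m ^ Suc j" by (rule binomial_fact_pow)
    finally have "real ((n choose j) * fact (Suc j)) \<le> real (m ^ Suc j)" by (rule of_nat_mono)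
    hence "(n choose j) * fact (Suc j) \<le> (sqrt m ^ Suc j)\<^sup>2"
      by (simp add: power_mult_distrib[symmetric] power2_eq_square del: fact_Suc power_Suc)
    hence "(n choose j) * fact (Suc j) / (fact (Suc j))\<^sup>2 \<le> (sqrt m ^ Suc j)\<^sup>2 / (fact (Suc j))\<^sup>2"
      by (rule divide_right_mono) simp
    also have "(n choose j) * fact (Suc j) / (fact (Suc j))\<^sup>2 = (n choose j) / (fact (Suc j) :: real)"
      by (simp add: power2_eq_square del: fact_Suc)
    also have "(sqrt m ^ Suc j)\<^sup>2 / (fact (Suc j))\<^sup>2 = b (Suc j) * b (Suc j)"
      by (simp add: b_def power_divide power2_eq_square del: fact_Suc)
    also have "b (Suc j) * b (Suc j) \<le> exp (sqrt m) * b (Suc j)"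
      using sum_b[of "{Suc j}"] b0 by (intro mult_right_mono) auto
    finally show ?thesis .
  qed
  have "lah_coeff m = (\<Sum>j<m. (n choose j) / fact (Suc j))"
    by (simp add: lah_coeff_def Suc)
  also have "\<dots> \<le> (\<Sum>j<m. exp (sqrt m) * b (Suc j))"
    by (intro sum_mono term_le)
  also have "\<dots> = exp (sqrt m) * sum b (Suc ` {..<m})"
    by (simp add: sum_distrib_left sum.reindex)
  also have "\<dots> \<le> exp (sqrt m) * exp (sqrt m)"
    by (intro mult_left_mono sum_b) auto
  also have "\<dots> = exp (2 * sqrt m)" by (simp flip: exp_add)
  finally show ?thesis .
qed (simp add: lah_coeff_def)

text \<open>The right side is a falling factorial whose \<open>s\<close> factors are all at least
  \<open>n - s\<close>.\<close>

lemma binomial_times_fact_ge: "(n - s) ^ s \<le> (n choose s) * fact s"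
proof (induction s)
  case (Suc s)
  have "(n - Suc s) ^ Suc s \<le> (n - s) ^ Suc s" by (intro power_mono) auto
  also have "\<dots> \<le> (n - s) * ((n choose s) * fact s)" using Suc.IH by simp
  also have "\<dots> = (n choose Suc s) * fact (Suc s)"
    by (metis binomial_absorb_comp binomial_absorption fact_Suc mult.assoc mult.commute of_nat_id)
  finally show ?case .
qed simp

text \<open>A weak Stirling bound, \<open>e * s * (s / e) ^ s\<close>. The induction step uses
  \<open>(s / (s + 1)) ^ (s + 1) \<le> exp (-1)\<close>.\<close>

lemma fact_upper:
  assumes "s \<ge> 1" shows "fact s \<le> exp (1 - real s) * real s ^ (s + 1)"
  using assms
proof (induction s rule: dec_induct)
  case (step s)
  have "real s / (s + 1) = 1 + (- (1 / (s + 1)))" by (simp add: field_simps)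
  also have "\<dots> \<le> exp (- (1 / (s + 1)))" by (rule exp_ge_add_one_self)
  finally have "(real s / (s + 1)) ^ (s + 1) \<le> exp (- (1 / (s + 1))) ^ (s + 1)"
    by (intro power_mono) auto
  also have "\<dots> = exp (real (s + 1) * (- (1 / (s + 1))))" by (rule exp_of_nat_mult[symmetric])
  also have "real (s + 1) * (- (1 / (s + 1))) = -1" by simp
  finally have *: "real s ^ (s + 1) \<le> exp (-1) * real (s + 1) ^ (s + 1)"
    by (simp add: power_divide divide_le_eq del: power_Suc)
  have "fact (Suc s) = real (s + 1) * fact s" by simp
  also have "\<dots> \<le> real (s + 1) * (exp (1 - real s) * (exp (-1) * real (s + 1) ^ (s + 1)))"
    using step.IH * by (intro mult_left_mono order.trans[OF step.IH]) auto
  also have "\<dots> = exp (1 - real s + -1) * real (s + 1) ^ (Suc s + 1)"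
    unfolding exp_add by simp
  finally show ?case by simp
qed simp

text \<open>A single summand suffices: for \<open>m = j\<^sup>2\<close> the one for permutations
  with \<open>j = sqrt m\<close> cycles, which has index \<open>s = j - 1\<close>.\<close>

lemma lah_coeff_lower:
  assumes "j \<ge> 2" shows "lah_coeff (j\<^sup>2) \<ge> exp (2 * real j - 3) / real j ^ 3"
proof -
  define s where "s = j - 1"
  have s: "j = Suc s" "s \<ge> 1" using assms by (auto simp: s_def)
  \<comment> \<open>\<open>n\<close> is \<open>j\<^sup>2 - 1\<close>, so that
    \<open>n - s = s * (s + 1)\<close>. The powers of \<open>s\<close> and of \<open>s + 1\<close>
    then match the Stirling bounds for \<open>fact s\<close> and
    \<open>fact (s + 1)\<close>.\<close>
  define n where "n = s * s + 2 * s"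
  have j2: "j\<^sup>2 = Suc n" by (simp add: s n_def power2_eq_square)
  have "(s * (s + 1)) ^ s \<le> (n choose s) * fact s"
    using binomial_times_fact_ge[of n s] by (simp add: n_def)
  hence "real ((s * (s + 1)) ^ s) \<le> real ((n choose s) * fact s)" by (rule of_nat_mono)
  hence b: "real s ^ s * real (s + 1) ^ s \<le> (n choose s) * fact s"
    by (simp only: power_mult_distrib of_nat_mult of_nat_power of_nat_fact)
  have "exp (2 * real j - 3) / real j ^ 3 \<le> exp (2 * real s - 1) / (s * real (s + 1) ^ 2)"
  proof -
    have "real s * real (s + 1) ^ 2 \<le> real j ^ 3"
      by (simp add: s power3_eq_cube power2_eq_square mult_right_mono)
    thus ?thesis using s by (simp add: divide_left_mono)
  qed
  also have "\<dots> = (real s ^ s * real (s + 1) ^ s) /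
      ((exp (1 - real s) * real s ^ (s + 1)) * (exp (1 - real (s + 1)) * real (s + 1) ^ (s + 1 + 1)))"
  proof -
    define p q a b t where "p = exp (1 - real s)" and "q = exp (1 - real (s + 1))"
      and "a = real s ^ s" and "b = real (s + 1) ^ s" and "t = real (s + 1)"
    have "exp (2 * real s - 1) = inverse (exp ((1 - real s) + (1 - real (s + 1))))"
      by (simp flip: exp_minus)
    also have "\<dots> = inverse (p * q)" unfolding exp_add p_def q_def ..
    finally have E: "exp (2 * real s - 1) = inverse (p * q)" .
    have pos: "p > 0" "q > 0" "a > 0" "b > 0" "t > 0" "real s > 0"
      using s by (simp_all add: p_def q_def a_def b_def t_def)
    have pw: "real s ^ (s + 1) = a * real s" "real (s + 1) ^ (s + 1 + 1) = b * t * t"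
      by (simp_all add: a_def b_def t_def)
    have "inverse (p * q) / (real s * t\<^sup>2) = a * b / ((p * (a * real s)) * (q * (b * t * t)))"
      using pos by (simp add: divide_simps power2_eq_square)
    thus ?thesis unfolding E pw by (simp only: p_def q_def a_def b_def t_def)
  qed
  also have "\<dots> \<le> (real s ^ s * real (s + 1) ^ s) / (fact s * fact (s + 1))"
    using s by (intro divide_left_mono mult_mono fact_upper) auto
  also have "\<dots> \<le> (n choose s) * fact s / (fact s * fact (s + 1))"
    by (intro divide_right_mono b) auto
  also have "\<dots> = (n choose s) / fact (Suc s)" by (simp del: fact_Suc)
  also have "\<dots> \<le> (\<Sum>j<Suc n. (n choose j) / fact (Suc j))"
    by (rule member_le_sum) (auto simp: n_def)
  also have "\<dots> = lah_coeff (j\<^sup>2)" by (simp add: j2 lah_coeff_def)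
  finally show ?thesis .
qed

section \<open>Bounds on the survival probabilities\<close>

lemma sum_lessThan_of_nat: "(\<Sum>i<m. real i) = real m * (real m - 1) / 2"
  by (induction m) (auto simp: field_simps)

lemma real_le_mult_real: "k > 0 \<Longrightarrow> real i \<le> real k * real i"
  unfolding of_nat_mult[symmetric] by (rule of_nat_mono) simp

text \<open>Each factor with index below \<open>r\<close> lies between 0 and 1.\<close>

lemma survival_antimono:
  assumes "k > 0" "i \<le> m" "m \<le> r"
  shows "survival k r m \<le> survival k r i" and "survival k r m \<ge> 0"
proof -
  have f: "0 \<le> real k * (real r - real i) / (real (k * r) - real i)"
    "real k * (real r - real i) / (real (k * r) - real i) \<le> 1" if "i < r" for i
  proof -
    note k = real_le_mult_real[OF assms(1), of r] real_le_mult_real[OF assms(1), of i]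
    have "real (k * r) - real i > 0" "real k * (real r - real i) \<le> real (k * r) - real i"
      unfolding of_nat_mult right_diff_distrib using that k by linarith+
    thus "0 \<le> real k * (real r - real i) / (real (k * r) - real i)"
      "real k * (real r - real i) / (real (k * r) - real i) \<le> 1"
      using that by simp_all
  qed
  show "survival k r m \<ge> 0"
    unfolding survival_def using assms f by (intro prod_nonneg) auto
  show "survival k r m \<le> survival k r i"
    using assms(2,3)
  proof (induction m rule: dec_induct)
    case (step m)
    have "survival k r (Suc m) = survival k r m * (real k * (real r - real m) / (real (k * r) - real m))"
      by (simp add: survival_def)
    also have "\<dots> \<le> survival k r m * 1"
      using step.prems f by (intro mult_left_mono) (auto simp: survival_def intro!: prod_nonneg)
    finally show ?case using step by simp
  qed simp
qed

context
  fixes k r :: nat and x :: real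
  assumes k: "k \<ge> 2" and r: "r \<ge> 1"
  defines "x \<equiv> real (k * r) / (real k - 1)"
begin

text \<open>The ratio \<open>k / (k - 1)\<close> lies between 1 and 2, so \<open>x\<close> and
  \<open>r\<close> are of the same order.\<close>

lemma x_bounds: "real r \<le> x" "x \<le> 2 * real r"
proof -
  have "real r * 1 \<le> real r * (real k - 1)" using k by (intro mult_left_mono) auto
  thus "real r \<le> x" "x \<le> 2 * real r"
    using k by (simp_all add: x_def field_simps)
qed

text \<open>The factor with index \<open>i\<close> is at most \<open>1 - i / x\<close>, hence at
  most \<open>exp (- (i / x))\<close>.\<close>

lemma survival_upper:
  assumes "m \<le> r"
  shows "survival k r m \<le> exp (- (real m * (real m - 1) / (2 * x)))"
proof -
  have "survival k r m \<le> (\<Prod>i<m. exp (- (real i / x)))"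
    unfolding survival_def
  proof (rule prod_mono)
    fix i assume "i \<in> {..<m}"
    hence i: "real i < real r" using assms by auto
    have n: "real (k * r) - real i > 0"
    proof -
      have "real r \<le> real k * real r" using k by (intro real_le_mult_real) simp
      thus ?thesis unfolding of_nat_mult using i by linarith
    qed
    have n0: "real (k * r) > 0" using k r by simp
    have "real k * (real r - real i) / (real (k * r) - real i) \<le> 1 + - (real i / x)"
    proof -
      \<comment> \<open>The two sides differ by \<open>(k - 1) * i\<^sup>2\<close>.\<close>
      have "(real k * (real r - real i)) * real (k * r) \<le>
          (real (k * r) - (real k - 1) * real i) * (real (k * r) - real i)"
      proof -
        have "0 \<le> (real k - 1) * (real i * real i)" using k by simp
        thus ?thesis by (simp add: algebra_simps)
      qed
      hence "real k * (real r - real i) / (real (k * r) - real i) \<le>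
          (real (k * r) - (real k - 1) * real i) / real (k * r)"
        using n n0 by (simp only: divide_le_eq le_divide_eq times_divide_eq_left) (simp only: if_True if_False mult.commute)
      also have "\<dots> = 1 + - (real i / x)" using k r by (simp add: x_def diff_divide_distrib)
      finally show ?thesis .
    qed
    also have "\<dots> \<le> exp (- (real i / x))" by (rule exp_ge_add_one_self)
    finally show "0 \<le> real k * (real r - real i) / (real (k * r) - real i) \<and>
       real k * (real r - real i) / (real (k * r) - real i) \<le> exp (- (real i / x))"
      using n i by simp
  qed
  also have "\<dots> = exp (- (real m * (real m - 1) / (2 * x)))"
    by (simp add: sum_lessThan_of_nat flip: exp_sum) (simp add: sum_negf flip: sum_divide_distrib add: sum_lessThan_of_nat)
  finally show ?thesis .
qed

text \<open>The reciprocal of a factor has the form \<open>1 + u\<close> and is bounded by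
  \<open>exp u\<close>.\<close>

lemma survival_lower:
  assumes "m \<le> r" "2 * real m < x"
  shows "survival k r m \<ge> exp (- ((real m)\<^sup>2 / (2 * (x - 2 * real m))))"
proof -
  have d: "x - 2 * real m > 0" using assms by simp
  have "exp (- ((real m)\<^sup>2 / (2 * (x - 2 * real m)))) \<le> exp (- (real m * (real m - 1) / (2 * (x - 2 * real m))))"
    using d by (simp add: divide_right_mono power2_eq_square algebra_simps)
  also have "real m * (real m - 1) / (2 * (x - 2 * real m)) = (\<Sum>i<m. real i) / (x - 2 * real m)"
    by (simp add: sum_lessThan_of_nat)
  also have "exp (- \<dots>) = (\<Prod>i<m. exp (- (real i / (x - 2 * real m))))"
    by (simp add: sum_negf sum_divide_distrib flip: exp_sum)
  also have "\<dots> \<le> survival k r m"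
    unfolding survival_def
  proof (rule prod_mono)
    fix i assume "i \<in> {..<m}"
    hence i: "real i < real m" "real i < real r" using assms by auto
    define a where "a = real k * (real r - real i)"
    have a: "a > 0" using i k by (simp add: a_def)
    \<comment> \<open>Here \<open>a / (k - 1) = x - k / (k - 1) * i\<close>, and the subtracted term
      is at most \<open>2 * m\<close>.\<close>
    have bd: "(real k - 1) * real i / a \<le> real i / (x - 2 * real m)"
    proof -
      have "real i * (real k - 2) \<ge> 0" using k by simp
      moreover have "(real k - 1) * real m \<ge> (real k - 1) * real i" using i k by (intro mult_left_mono) auto
      moreover have "(real k - 1) * x = real k * real r" using k by (simp add: x_def)
      ultimately have "(real k - 1) * (x - 2 * real m) \<le> a"
        by (simp add: a_def algebra_simps)
      hence "real i * ((real k - 1) * (x - 2 * real m)) \<le> real i * a" by (intro mult_left_mono) auto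
      thus ?thesis using a d by (simp add: divide_le_eq le_divide_eq mult_ac)
    qed
    have eq: "real (k * r) - real i = a + (real k - 1) * real i" by (simp add: a_def algebra_simps)
    have pos: "a + (real k - 1) * real i > 0" using a k by (intro add_pos_nonneg) auto
    have "(a + (real k - 1) * real i) / a = 1 + (real k - 1) * real i / a"
      using a by (simp add: field_simps)
    also have "\<dots> \<le> exp ((real k - 1) * real i / a)" by (rule exp_ge_add_one_self)
    also have "\<dots> \<le> exp (real i / (x - 2 * real m))" using bd by simp
    finally have "inverse (exp (real i / (x - 2 * real m))) \<le> inverse ((a + (real k - 1) * real i) / a)"
      using a pos by (intro le_imp_inverse_le) auto
    thus "0 \<le> exp (- (real i / (x - 2 * real m))) \<and>
       exp (- (real i / (x - 2 * real m))) \<le> real k * (real r - real i) / (real (k * r) - real i)"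
      unfolding eq a_def[symmetric] by (simp add: exp_minus)
  qed
  finally show ?thesis .
qed

text \<open>With \<open>y = x powr (1/3)\<close> and \<open>sqrt m = y * v\<close> this reduces to \<open>v ^ 4 - 4 * v + 3 \<ge> 0\<close>.\<close>

lemma exponent_le:
  assumes "m \<le> r"
  shows "2 * sqrt m - real m * (real m - 1) / (2 * x) \<le> 3 / 2 * x powr (1 / 3) + 1 / 2"
proof -
  define y where "y = x powr (1 / 3)"
  have x0: "x > 0" using x_bounds r by simp
  have y0: "y > 0" using x0 by (simp add: y_def)
  have y3: "y ^ 3 = x" using x0 by (simp add: y_def powr_powr flip: powr_realpow)
  define v where "v = sqrt m / y"
  have sm: "sqrt m = y * v" using y0 by (simp add: v_def)
  have m: "real m = y\<^sup>2 * v\<^sup>2" using sm by (metis of_nat_0_le_iff power_mult_distrib real_sqrt_pow2)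
  have "0 \<le> (v - 1)\<^sup>2 * ((v + 1)\<^sup>2 + 2)" by simp
  also have "\<dots> = v ^ 4 - 4 * v + 3" by (simp add: power2_eq_square power4_eq_xxxx algebra_simps)
  finally have "0 \<le> y * (v ^ 4 - 4 * v + 3) / 2" using y0 by simp
  moreover have "(real m)\<^sup>2 / (2 * x) = y * v ^ 4 / 2"
    unfolding m y3[symmetric] using y0 by (simp add: power2_eq_square power3_eq_cube power4_eq_xxxx)
  \<comment> \<open>The linear part of \<open>m * (m - 1)\<close> accounts for the constant 1/2 in
    the bound.\<close>
  moreover have "real m / (2 * x) \<le> 1 / 2" using assms x_bounds x0 by (simp add: divide_le_eq)
  moreover have "real m * (real m - 1) / (2 * x) = (real m)\<^sup>2 / (2 * x) - real m / (2 * x)"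
    by (simp add: power2_eq_square algebra_simps diff_divide_distrib)
  ultimately show ?thesis unfolding sm y_def[symmetric] by (simp add: algebra_simps)
qed

section \<open>Bounds on the expectation\<close>

text \<open>All \<open>r + 1\<close> terms are bounded by the maximal exponential. Their number is
  polynomial in \<open>x\<close> and disappears in the logarithm.\<close>

lemma expected_B_upper: "expected_B k (k * r) \<le> (x + 1) * exp (3 / 2 * x powr (1 / 3) + 1 / 2)"
proof -
  have "expected_B k (k * r) = (\<Sum>m\<le>r. survival k r m * lah_diff m)"
    using k by (intro expected_B_eq) simp
  also have "\<dots> \<le> (\<Sum>m\<le>r. exp (3 / 2 * x powr (1 / 3) + 1 / 2))"
  proof (rule sum_mono)
    fix m assume "m \<in> {..r}"
    hence m: "m \<le> r" by simp
    have "lah_diff m \<le> lah_coeff m" 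
      using lah_coeff_nonneg[of "m - 1"] by (cases "m = 0") (simp_all add: lah_diff_def lah_coeff_def)
    also have "\<dots> \<le> exp (2 * sqrt m)" by (rule lah_coeff_upper)
    finally have "survival k r m * lah_diff m \<le>
        exp (- (real m * (real m - 1) / (2 * x))) * exp (2 * sqrt m)"
      by (intro mult_mono survival_upper m lah_diff_nonneg) auto
    also have "\<dots> \<le> exp (3 / 2 * x powr (1 / 3) + 1 / 2)"
      using exponent_le[OF m] by (simp flip: exp_add)
    finally show "survival k r m * lah_diff m \<le> exp (3 / 2 * x powr (1 / 3) + 1 / 2)" .
  qed
  also have "\<dots> = (real r + 1) * exp (3 / 2 * x powr (1 / 3) + 1 / 2)" by simp
  also have "\<dots> \<le> (x + 1) * exp (3 / 2 * x powr (1 / 3) + 1 / 2)"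
    using x_bounds by (intro mult_right_mono) auto
  finally show ?thesis .
qed

text \<open>Summation by parts: the weights \<open>survival k r i\<close> decrease in \<open>i\<close>.\<close>

lemma expected_B_ge:
  assumes "m \<le> r" shows "expected_B k (k * r) \<ge> survival k r m * lah_coeff m"
proof -
  have k0: "k > 0" using k by simp
  have "survival k r m * lah_coeff m = (\<Sum>i\<le>m. survival k r m * lah_diff i)"
    by (simp add: sum_distrib_left flip: sum_lah_diff)
  also have "\<dots> \<le> (\<Sum>i\<le>m. survival k r i * lah_diff i)"
    using assms by (intro sum_mono mult_right_mono survival_antimono k0 lah_diff_nonneg) auto
  also have "\<dots> \<le> (\<Sum>i\<le>r. survival k r i * lah_diff i)"
    using assms by (intro sum_mono2 mult_nonneg_nonneg lah_diff_nonneg survival_antimono(2)[OF k0 order.refl]) auto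
  also have "\<dots> = expected_B k (k * r)" using k by (intro expected_B_eq[symmetric]) simp
  finally show ?thesis .
qed

text \<open>One size \<open>m = j\<^sup>2\<close> is used, a square because
  \<open>lah_coeff_lower\<close> is stated for squares. For \<open>j\<close> near
  \<open>x powr (1/3)\<close> it is near the maximizer, and the exponent is about
  \<open>2 * j - j / 2\<close>.\<close>

lemma expected_B_lower:
  assumes j: "3 \<le> j" "real j \<le> x powr (1 / 3)"
  shows "exp (2 * real j - 3 - 3 * ln j - (real j)\<^sup>2 / (2 * (real j - 2))) \<le> expected_B k (k * r)"
proof -
  define y where "y = x powr (1 / 3)"
  have x0: "x > 0" using x_bounds r by simp
  have y3: "y ^ 3 = x" using x0 by (simp add: y_def powr_powr flip: powr_realpow)
  have jy: "real j \<le> y" using j by (simp add: y_def)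
  have j3: "real j ^ 3 \<le> x" unfolding y3[symmetric] using jy by (intro power_mono) auto
  \<comment> \<open>Since \<open>y \<ge> 2\<close> and \<open>x \<le> 2 * r\<close>, the chosen size
    does not exceed \<open>r\<close>.\<close>
  have "2 * (real j)\<^sup>2 \<le> 2 * y\<^sup>2" using jy by (intro mult_left_mono power_mono) auto
  also have "\<dots> \<le> y * y\<^sup>2" using jy j by (intro mult_right_mono) auto
  also have "\<dots> = x" unfolding y3[symmetric] by (simp add: power2_eq_square power3_eq_cube)
  finally have "2 * (real j)\<^sup>2 \<le> 2 * real r" using x_bounds by linarith
  hence "real (j\<^sup>2) \<le> real r" unfolding of_nat_power by linarith
  hence jr: "j\<^sup>2 \<le> r" by (simp only: of_nat_le_iff)
  have j2: "(real j)\<^sup>2 > 0" using j by simp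
  \<comment> \<open>From \<open>j ^ 3 \<le> x\<close>; the right side is positive because
    \<open>j \<ge> 3\<close>.\<close>
  have d: "(real j)\<^sup>2 * (real j - 2) \<le> x - 2 * real (j\<^sup>2)"
    using j3 by (simp add: power2_eq_square power3_eq_cube algebra_simps)
  have d0: "(real j)\<^sup>2 * (real j - 2) > 0" using j2 j by simp
  with d have d1: "x - 2 * real (j\<^sup>2) > 0" by linarith
  have "(real (j\<^sup>2))\<^sup>2 / (2 * (x - 2 * real (j\<^sup>2))) \<le> (real (j\<^sup>2))\<^sup>2 / (2 * ((real j)\<^sup>2 * (real j - 2)))"
    using d d0 d1 by (intro divide_left_mono mult_pos_pos[OF _ d1] mult_pos_pos[OF _ d0] mult_left_mono) auto
  also have "\<dots> = (real j)\<^sup>2 / (2 * (real j - 2))"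
    using j j2 by (simp add: power2_eq_square)
  finally have e: "(real (j\<^sup>2))\<^sup>2 / (2 * (x - 2 * real (j\<^sup>2))) \<le> (real j)\<^sup>2 / (2 * (real j - 2))" .
  have "exp (2 * real j - 3 - 3 * ln j - (real j)\<^sup>2 / (2 * (real j - 2))) =
      exp (- ((real j)\<^sup>2 / (2 * (real j - 2)))) * (exp (2 * real j - 3) / exp (3 * ln j))"
    by (simp flip: exp_diff exp_add)
  also have "exp (3 * ln j) = real j ^ 3"
    using j exp_of_nat_mult[of 3 "ln j"] by simp
  also have "exp (- ((real j)\<^sup>2 / (2 * (real j - 2)))) * (exp (2 * real j - 3) / real j ^ 3) \<le>
      exp (- ((real (j\<^sup>2))\<^sup>2 / (2 * (x - 2 * real (j\<^sup>2))))) * lah_coeff (j\<^sup>2)"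
    using e j by (intro mult_mono lah_coeff_lower) auto
  also have "\<dots> \<le> survival k r (j\<^sup>2) * lah_coeff (j\<^sup>2)"
    using survival_lower[OF jr] d1 by (intro mult_right_mono lah_coeff_nonneg) linarith
  also have "\<dots> \<le> expected_B k (k * r)" by (rule expected_B_ge[OF jr])
  finally show ?thesis .
qed

end

theorem theorem4p3:
  fixes k n :: "nat \<Rightarrow> nat" and \<alpha> :: real
  assumes "\<And>r. r \<ge> 1 \<Longrightarrow> k r \<ge> 2"
    and "\<And>r. r \<ge> 1 \<Longrightarrow> n r = k r * r"
    and "0 < \<alpha>" and "\<alpha> < 1"
    and "(\<lambda>r. real (k r)) \<in> o[at_top](\<lambda>r. real (n r) powr (1 - \<alpha>))"
  shows "(\<lambda>r. ln (expected_B (k r) (n r)))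
           \<sim>[at_top] (\<lambda>r. 3 / 2 * (real (n r) / (real (k r) - 1)) powr (1 / 3))"
proof -
  define x where "x = (\<lambda>r. real (n r) / (real (k r) - 1))"
  define y where "y = (\<lambda>r. x r powr (1 / 3))"
  \<comment> \<open>Rounding \<open>y\<close> down gives the square \<open>j\<^sup>2\<close> closest
    to \<open>x powr (2/3)\<close> from below.\<close>
  define j where "j = (\<lambda>r. nat \<lfloor>y r\<rfloor>)"
  \<comment> \<open>\<open>U\<close> and \<open>L\<close> are the logarithms of the upper and lower
    bounds, with \<open>x\<close> written as \<open>y ^ 3\<close>.\<close>
  define U where "U = (\<lambda>t :: real. ln (t ^ 3 + 1) + 3 / 2 * t + 1 / 2)"
  define L where "L = (\<lambda>t :: real. 2 * t - 3 - 3 * ln t - t\<^sup>2 / (2 * (t - 2)))"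
  have xr: "real r \<le> x r" if "r \<ge> 1" for r
    using x_bounds(1)[OF assms(1) that] that assms(2) by (simp add: x_def)
  have xlim: "filterlim x at_top at_top"
    by (rule filterlim_at_top_mono[OF filterlim_real_sequentially])
       (use xr in \<open>auto simp: eventually_at_top_linorder intro!: exI[of _ 1]\<close>)
  have ylim: "filterlim y at_top at_top"
    unfolding y_def by (rule filterlim_compose[OF _ xlim]) real_asymp
  have y3: "eventually (\<lambda>r. y r \<ge> 3) at_top"
    using ylim by (simp add: filterlim_at_top)
  have ev: "eventually (\<lambda>r. L (real_of_int \<lfloor>y r\<rfloor>) \<le> ln (expected_B (k r) (n r)) \<and>
      ln (expected_B (k r) (n r)) \<le> U (y r)) at_top"
    using y3 eventually_ge_at_top[of 1]
  proof eventually_elim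
    case (elim r)
    have k: "k r \<ge> 2" and n: "n r = k r * r" using assms elim by auto
    have x: "x r = real (k r * r) / (real (k r) - 1)" by (simp add: x_def n)
    have x0: "x r > 0" using xr elim by fastforce
    have x3: "y r ^ 3 = x r" using x0 by (simp add: y_def powr_powr flip: powr_realpow)
    have fl: "real (j r) = real_of_int \<lfloor>y r\<rfloor>" using elim by (simp add: j_def)
    have j: "3 \<le> j r" "real (j r) \<le> y r" 
      using elim by (auto simp: j_def le_nat_iff le_floor_iff)
    have lo: "exp (L (real (j r))) \<le> expected_B (k r) (n r)"
      using expected_B_lower[OF k elim(2) j(1)] j(2) unfolding n L_def y_def x by simp
    hence pos: "expected_B (k r) (n r) > 0" by (rule less_le_trans[OF exp_gt_zero])
    have "expected_B (k r) (n r) \<le> (x r + 1) * exp (3 / 2 * y r + 1 / 2)"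
      using expected_B_upper[OF k elim(2)] unfolding n y_def x by simp
    hence "ln (expected_B (k r) (n r)) \<le> ln ((x r + 1) * exp (3 / 2 * y r + 1 / 2))"
      using pos by simp
    also have "\<dots> = U (y r)" using x0 by (simp add: ln_mult U_def x3)
    finally show ?case using lo pos by (simp add: ln_ge_iff fl)
  qed
  have U: "((\<lambda>t. U t / (3 / 2 * t)) \<longlongrightarrow> 1) at_top" unfolding U_def by real_asymp
  \<comment> \<open>The last term of \<open>L\<close> grows like \<open>t / 2\<close>, which leaves
    \<open>3 / 2 * t\<close>; rounding \<open>t\<close> down changes only lower order terms.\<close>
  have L: "((\<lambda>t. L (real_of_int \<lfloor>t\<rfloor>) / (3 / 2 * t)) \<longlongrightarrow> 1) at_top" unfolding L_def by real_asymp
  have "((\<lambda>r. ln (expected_B (k r) (n r)) / (3 / 2 * y r)) \<longlongrightarrow> 1) at_top"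
  proof (rule tendsto_sandwich)
    show "eventually (\<lambda>r. L (real_of_int \<lfloor>y r\<rfloor>) / (3 / 2 * y r) \<le> ln (expected_B (k r) (n r)) / (3 / 2 * y r)) at_top"
      using ev y3 by eventually_elim (auto intro!: divide_right_mono)
    show "eventually (\<lambda>r. ln (expected_B (k r) (n r)) / (3 / 2 * y r) \<le> U (y r) / (3 / 2 * y r)) at_top"
      using ev y3 by eventually_elim (auto intro!: divide_right_mono)
    show "((\<lambda>r. L (real_of_int \<lfloor>y r\<rfloor>) / (3 / 2 * y r)) \<longlongrightarrow> 1) at_top"
      by (rule filterlim_compose[OF L ylim])
    show "((\<lambda>r. U (y r) / (3 / 2 * y r)) \<longlongrightarrow> 1) at_top"
      by (rule filterlim_compose[OF U ylim])
  qed
  thus ?thesis unfolding y_def x_def by (rule asymp_equivI')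
qed

end
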